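(* Let $(X,\phi)$ be a convex geometry (on a finite set $X$) given by an implicational basis $S=\{A_i\to B_i\}$, with $|X|=n$, $|S|=m$ and $s(S)=k$, where $s(S)=\sum_i|A_i|+\sum_i|B_i|$. The number of steps required to verify that $(X,\phi)$ has convex dimension $cdim=2$ is $O((k+m)n^3)$.
   Context: All ground sets are finite. A closure operator on $X$ is a map $\phi:2^X\to 2^X$ with $Y\subseteq\phi(Y)$, $Y\subseteq Z\Rightarrow\phi(Y)\subseteq\phi(Z)$, and $\phi(\phi(Y))=\phi(Y)$. $(X,\phi)$ is a convex geometry if moreover $\phi(\emptyset)=\emptyset$ and the anti-exchange property holds: if $Y=\phi(Y)$ and $x\neq z$ are not in $Y$, then $z\in\phi(Y\cup\{x\})$ implies $x\notin\phi(Y\cup\{z\})$. An implication $A\to B$ ($A,B\subseteq X$) of $(X,\phi)$ is the statement that $B\subseteq\phi(A)$. A set $S$ of implications of $(X,\phi)$ is an implicational basis of $(X,\phi)$ if every implication that holds in $(X,\phi)$ is a logical consequence of $S$; equivalently, for every $Y\subseteq X$, $\phi(Y)$ is the smallest set $Z\supseteq Y$ such that $A\subseteq Z$ implies $B\subseteq Z$ for every $(A\to B)\in S$. A linear alignment on $X$ is a family $\{\emptyset,\{x_1\},\{x_1,x_2\},\dots,\{x_1,\dots,x_n\}=X\}$ for a total ordering $x_1<\dots<x_n$ of $X$. For families $\mathcal F_1,\mathcal F_2$ of subsets of $X$, $\mathcal F_1+\mathcal F_2=\{U\cap V:U\in\mathcal F_1,\ V\in\mathcal F_2\}$. The convex dimension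 $cdim$ of $(X,\phi)$ is the minimal number of linear alignments on $X$ whose sum is the family of closed sets $\{Y\subseteq X:\phi(Y)=Y\}$. *)

theory Defs
  imports Main
begin

section \<open>Convex geometries\<close>

locale closure_operator =
  fixes X :: "'a set" and \<phi> :: "'a set \<Rightarrow> 'a set"
  assumes finite_ground: "finite X"
    and closure_subset: "Y \<subseteq> X \<Longrightarrow> \<phi> Y \<subseteq> X"
    and extensive: "Y \<subseteq> X \<Longrightarrow> Y \<subseteq> \<phi> Y"
    and monotone: "Z \<subseteq> X \<Longrightarrow> Y \<subseteq> Z \<Longrightarrow> \<phi> Y \<subseteq> \<phi> Z"
    and idempotent: "Y \<subseteq> X \<Longrightarrow> \<phi> (\<phi> Y) = \<phi> Y"

locale convex_geometry = closure_operator +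
  assumes closure_empty: "\<phi> {} = {}"
    and anti_exchange:
      "\<lbrakk>Y \<subseteq> X; Y = \<phi> Y; x \<in> X - Y; z \<in> X - Y; x \<noteq> z; z \<in> \<phi> (Y \<union> {x})\<rbrakk>
       \<Longrightarrow> x \<notin> \<phi> (Y \<union> {z})"

definition closed_sets :: "'a set \<Rightarrow> ('a set \<Rightarrow> 'a set) \<Rightarrow> 'a set set" where
  "closed_sets X \<phi> = {Y. Y \<subseteq> X \<and> \<phi> Y = Y}"


section \<open>Implicational bases\<close>

text \<open>The implication \<open>A \<rightarrow> B\<close> is the pair \<open>(A, B)\<close>.\<close>

type_synonym 'a implication = "'a set \<times> 'a set"

definition holds_in :: "'a set \<Rightarrow> ('a set \<Rightarrow> 'a set) \<Rightarrow> 'a implication \<Rightarrow> bool" where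
  "holds_in X \<phi> = (\<lambda>(A, B). A \<subseteq> X \<and> B \<subseteq> X \<and> B \<subseteq> \<phi> A)"

definition satisfies :: "'a set \<Rightarrow> 'a implication \<Rightarrow> bool" where
  "satisfies Z = (\<lambda>(A, B). A \<subseteq> Z \<longrightarrow> B \<subseteq> Z)"

definition logical_consequence :: "'a set \<Rightarrow> 'a implication set \<Rightarrow> 'a implication \<Rightarrow> bool" where
  "logical_consequence X S i \<longleftrightarrow> (\<forall>Z\<subseteq>X. (\<forall>j\<in>S. satisfies Z j) \<longrightarrow> satisfies Z i)"

definition implicational_basis ::
  "'a set \<Rightarrow> ('a set \<Rightarrow> 'a set) \<Rightarrow> 'a implication set \<Rightarrow> bool" where
  "implicational_basis X \<phi> S \<longleftrightarrow>
     (\<forall>i\<in>S. holds_in X \<phi> i) \<and> (\<forall>i. holds_in X \<phi> i \<longrightarrow> logical_consequence X S i)"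

definition basis_size :: "'a implication set \<Rightarrow> nat" where
  "basis_size S = (\<Sum>(A, B)\<in>S. card A + card B)"


section \<open>Convex dimension\<close>

definition linear_alignment :: "'a set \<Rightarrow> 'a set set \<Rightarrow> bool" where
  "linear_alignment X F \<longleftrightarrow>
     (\<exists>xs. distinct xs \<and> set xs = X \<and> F = {set (take i xs) | i. i \<le> length xs})"

definition family_sum :: "'a set set \<Rightarrow> 'a set set \<Rightarrow> 'a set set" where
  "family_sum F G = {U \<inter> V | U V. U \<in> F \<and> V \<in> G}"

text \<open>
  The family \<open>{X}\<close> is neutral for sums of families of subsets of \<open>X\<close>, so the fold below
  is \<open>F\<^sub>1 + \<dots> + F\<^sub>d\<close> for every non-empty list.
\<close>

definition is_alignment_sum :: "'a set \<Rightarrow> ('a set \<Rightarrow> 'a set) \<Rightarrow> 'a set set list \<Rightarrow> bool" where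
  "is_alignment_sum X \<phi> Fs \<longleftrightarrow>
     Fs \<noteq> [] \<and> (\<forall>F\<in>set Fs. linear_alignment X F) \<and>
     foldr family_sum Fs {X} = closed_sets X \<phi>"

definition cdim :: "'a set \<Rightarrow> ('a set \<Rightarrow> 'a set) \<Rightarrow> nat" where
  "cdim X \<phi> = (LEAST d. \<exists>Fs. length Fs = d \<and> is_alignment_sum X \<phi> Fs)"


section \<open>Step counting on a unit-cost random access machine\<close>

text \<open>
  A machine has registers and a memory, both indexed by natural numbers and holding natural
  numbers; a program names only finitely many registers. The arithmetic is the usual one for
  the uniform cost measure: addition and truncated subtraction, but no multiplication.
  Every elementary instruction and every evaluation of a branching or loop test is one step.
\<close>

datatype program =
    Skip
  | Const nat nat
  | Add nat nat nat
  | Sub nat nat nat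
  | Load nat nat
  | Store nat nat
  | Seq program program
  | IfNonzero nat program program
  | WhileNonzero nat program

type_synonym state = "(nat \<Rightarrow> nat) \<times> (nat \<Rightarrow> nat)"

text \<open>
  \<open>exec P s t s'\<close>: started in state \<open>s\<close>, the program \<open>P\<close> halts after exactly \<open>t\<close> steps in
  state \<open>s'\<close>. The first component \<open>r\<close> of a state contains the registers, the second the memory.
\<close>

inductive exec :: "program \<Rightarrow> state \<Rightarrow> nat \<Rightarrow> state \<Rightarrow> bool" where
  Skip: "exec Skip s 1 s"
| Const: "exec (Const i c) (r, M) 1 (r(i := c), M)"
| Add: "exec (Add i j l) (r, M) 1 (r(i := r j + r l), M)"
| Sub: "exec (Sub i j l) (r, M) 1 (r(i := r j - r l), M)"
| Load: "exec (Load i j) (r, M) 1 (r(i := M (r j)), M)"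
| Store: "exec (Store i j) (r, M) 1 (r, M(r i := r j))"
| Seq: "\<lbrakk>exec P s t s'; exec Q s' u s''\<rbrakk> \<Longrightarrow> exec (Seq P Q) s (t + u) s''"
| IfTrue: "\<lbrakk>fst s i \<noteq> 0; exec P s t s'\<rbrakk> \<Longrightarrow> exec (IfNonzero i P Q) s (Suc t) s'"
| IfFalse: "\<lbrakk>fst s i = 0; exec Q s t s'\<rbrakk> \<Longrightarrow> exec (IfNonzero i P Q) s (Suc t) s'"
| WhileFalse: "fst s i = 0 \<Longrightarrow> exec (WhileNonzero i P) s 1 s"
| WhileTrue: "\<lbrakk>fst s i \<noteq> 0; exec P s t s'; exec (WhileNonzero i P) s' u s''\<rbrakk>
    \<Longrightarrow> exec (WhileNonzero i P) s (Suc (t + u)) s''"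

inductive_cases exec_elims:
  "exec Skip s t s'" "exec (Const i c) s t s'" "exec (Add i j l) s t s'"
  "exec (Sub i j l) s t s'" "exec (Load i j) s t s'" "exec (Store i j) s t s'"

inductive_cases exec_SeqE: "exec (Seq P Q) s t s'"
inductive_cases exec_IfE: "exec (IfNonzero i P Q) s t s'"
inductive_cases exec_WhileE: "exec (WhileNonzero i P) s t s'"

lemma exec_deterministic:
  "exec P s t s' \<Longrightarrow> exec P s u s'' \<Longrightarrow> t = u \<and> s' = s''"
proof (induction arbitrary: u s'' rule: exec.induct)
  case (Seq P s t s' Q v s2)
  from Seq.prems show ?case
    by (rule exec_SeqE) (use Seq.IH in blast)
next
  case (IfTrue s i P t s' Q)
  from IfTrue.prems show ?case
    by (rule exec_IfE) (use IfTrue.hyps(1) IfTrue.IH in fastforce)+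
next
  case (IfFalse s i Q t s' P)
  from IfFalse.prems show ?case
    by (rule exec_IfE) (use IfFalse.hyps(1) IfFalse.IH in fastforce)+
next
  case (WhileFalse s i P)
  from WhileFalse.prems show ?case
    by (rule exec_WhileE) (use WhileFalse.hyps in simp_all)
next
  case (WhileTrue s i P t s' v s2)
  from WhileTrue.prems show ?case
  proof (rule exec_WhileE)
    assume "fst s i = 0"
    with WhileTrue.hyps(1) show ?thesis by simp
  next
    fix t1 s1 u1
    assume "u = Suc (t1 + u1)" "exec P s t1 s1" "exec (WhileNonzero i P) s1 u1 s''"
    with WhileTrue.IH show ?thesis by blast
  qed
qed (auto elim: exec_elims)

definition initial_state :: "nat list \<Rightarrow> state" where
  "initial_state input = ((\<lambda>_. 0), (\<lambda>a. if a < length input then input ! a else 0))"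

definition answer :: "state \<Rightarrow> nat" where
  "answer s = fst s 0"


section \<open>Presenting a basis to the machine\<close>

text \<open>
  The ground set is named by \<open>0, \<dots>, n - 1\<close> through an enumeration \<open>e\<close>, and \<open>S\<close> is written
  down by listing each implication once, each side without repetitions and in any order.
\<close>

type_synonym listed_implication = "nat list \<times> nat list"

definition denoted :: "(nat \<Rightarrow> 'a) \<Rightarrow> listed_implication \<Rightarrow> 'a implication" where
  "denoted e = (\<lambda>(as, bs). (e ` set as, e ` set bs))"

definition lists_basis ::
  "'a set \<Rightarrow> 'a implication set \<Rightarrow> (nat \<Rightarrow> 'a) \<Rightarrow> listed_implication list \<Rightarrow> bool" where
  "lists_basis X S e L \<longleftrightarrow>
     bij_betw e {..<card X} X \<and>
     (\<forall>(as, bs)\<in>set L. distinct as \<and> distinct bs \<and>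
        set as \<subseteq> {..<card X} \<and> set bs \<subseteq> {..<card X}) \<and>
     distinct (map (denoted e) L) \<and> S = denoted e ` set L"

definition encode_implication :: "listed_implication \<Rightarrow> nat list" where
  "encode_implication = (\<lambda>(as, bs). length as # as @ length bs # bs)"

definition encode :: "nat \<Rightarrow> listed_implication list \<Rightarrow> nat list" where
  "encode n L = n # length L # concat (map encode_implication L)"

end

theory Submission
  imports Defs
begin

text \<open>
  Ranking the points by two injective functions \<open>f\<close> and \<open>g\<close> gives two linear alignments, the
  families of initial segments of \<open>f\<close> and of \<open>g\<close>. Their sum is the family of closed sets exactly
  if the closure of every non-empty \<open>Y\<close> consists of the points that are bounded by some point of
  \<open>Y\<close> under \<open>f\<close> and by some, possibly different, point of \<open>Y\<close> under \<open>g\<close>; such a pair is called a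
  realizer below. Hence \<open>cdim = 2\<close> means that there is a realizer, but none with \<open>f = g\<close>
  (\<open>cdim_eq_2_iff\<close>).

  A realizer is searched for from the top. If one exists, then a closed set has at most two
  extreme points: its maximum under \<open>f\<close> and its maximum under \<open>g\<close>. The two rankings are therefore
  built by alternately removing an extreme point from the set of points that the one ranking has
  not ranked yet, and always taking an extreme point whose rank under the other ranking is
  smallest, where unranked points have rank \<open>0\<close>. Suppose that this takes the wrong extreme point.
  Then that point is ranked no higher than the right one in the other ranking, although it is the
  maximum there, so both are still unranked in it. The two sets of unranked points then coincide,
  all points ranked so far lie above them in both orders, and exchanging the two orders below that
  level turns the realizer into one for which the choice was right. So the search never backtracks,
  and it ends in a realizer whenever there is one (\<open>peeling_finds_realizer\<close>). The initial segments
  of the rankings it produces are closed in any case, and for that reason a candidate can be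
  verified by looking at the closures of pairs of points only (\<open>realizer_iff_pairs\<close>). If it is
  a realizer, then one with equal components exists exactly if its own two rankings are equal
  (\<open>peeling_equal_iff_chain\<close>).

  The search makes \<open>2 n\<close> choices with \<open>n\<close> tests for extremality each, the verification treats
  \<open>n\<^sup>2\<close> pairs, and each test and each pair needs one closure. A closure is obtained by \<open>n\<close> passes
  through the list of implications (\<open>iterated_pass_eq_closure\<close>), and a pass takes time
  \<open>O(k + m)\<close>, which gives \<open>O((k + m) n\<^sup>3)\<close> in total. If the basis is empty, the
  bound leaves only constant time, whatever \<open>n\<close> is. In that case all sets are closed, which
  rules out a realizer on three or more points (\<open>closure_of_two_points_is_large\<close>), so that it
  suffices to compare \<open>n\<close> with \<open>2\<close> before the search starts.

  The machine programs are verified with a weakest precondition \<open>wp\<close> whose postconditions also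
  see the number of steps. The lemmas on programs have the form: if \<open>Q\<close> holds in all states
  that fulfil the specification, then \<open>Q\<close> holds after the program. Such lemmas can be applied
  as rules inside larger programs.
\<close>



section \<open>Rankings and linear alignments\<close>

definition initial_segments :: "'a set \<Rightarrow> ('a \<Rightarrow> nat) \<Rightarrow> 'a set set" where
  "initial_segments X f = {U. U \<subseteq> X \<and> (\<forall>y\<in>U. \<forall>x\<in>X. f x \<le> f y \<longrightarrow> x \<in> U)}"

definition realizer ::
  "'a set \<Rightarrow> ('a set \<Rightarrow> 'a set) \<Rightarrow> ('a \<Rightarrow> nat) \<Rightarrow> ('a \<Rightarrow> nat) \<Rightarrow> bool" where
  "realizer X \<phi> f g \<longleftrightarrow> inj_on f X \<and> inj_on g X \<and>
     (\<forall>Y\<subseteq>X. Y \<noteq> {} \<longrightarrow> \<phi> Y = {x\<in>X. (\<exists>a\<in>Y. f x \<le> f a) \<and> (\<exists>b\<in>Y. g x \<le> g b)})"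

lemma prefixes_eq_initial_segments:
  fixes f :: "'a \<Rightarrow> nat"
  assumes "set xs = X"
    and mono: "\<And>i j. i < length xs \<Longrightarrow> j < length xs \<Longrightarrow> f (xs ! i) \<le> f (xs ! j) \<longleftrightarrow> i \<le> j"
  shows "{set (take i xs) | i. i \<le> length xs} = initial_segments X f"
proof (intro set_eqI iffI)
  fix U assume "U \<in> {set (take i xs) | i. i \<le> length xs}"
  then obtain i where i: "i \<le> length xs" "U = (!) xs ` {..<i}"
    by (auto simp flip: nth_image simp: atLeast0LessThan)
  show "U \<in> initial_segments X f"
    unfolding initial_segments_def
  proof (intro CollectI conjI ballI impI)
    show "U \<subseteq> X" using i assms(1) by auto
    fix y x assume y: "y \<in> U" and x: "x \<in> X" and le: "f x \<le> f y"
    obtain j where j: "j < i" "y = xs ! j" using y i by auto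
    obtain l where l: "l < length xs" "x = xs ! l"
      using x assms(1) by (metis in_set_conv_nth)
    have "l \<le> j" using le mono[of l j] i j l by auto
    then show "x \<in> U" using i j l by auto
  qed
next
  fix U assume U: "U \<in> initial_segments X f"
  define i where "i = (LEAST i. i = length xs \<or> xs ! i \<notin> U)"
  have i: "i = length xs \<or> xs ! i \<notin> U"
    unfolding i_def by (rule LeastI_ex) blast
  have ile: "i \<le> length xs" unfolding i_def by (rule Least_le) simp
  have below: "xs ! j \<in> U" if "j < i" for j
    using not_less_Least[of j "\<lambda>i. i = length xs \<or> xs ! i \<notin> U"] that i_def by auto
  have "U \<subseteq> (!) xs ` {..<i}"
  proof
    fix x assume x: "x \<in> U"
    then have "x \<in> X" using U by (auto simp: initial_segments_def)
    then obtain j where j: "j < length xs" "x = xs ! j"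
      using assms(1) by (metis in_set_conv_nth)
    have "j < i"
    proof (rule ccontr)
      assume "\<not> j < i"
      then have il: "i < length xs" using j by simp
      then have "f (xs ! i) \<le> f x" using mono[of i j] j \<open>\<not> j < i\<close> by simp
      then have "xs ! i \<in> U"
        using U x il assms(1) unfolding initial_segments_def by auto
      then show False using i il by simp
    qed
    then show "x \<in> (!) xs ` {..<i}" using j by auto
  qed
  then have "U = (!) xs ` {..<i}" using below by auto
  then have "U = set (take i xs)" using nth_image[OF ile] by (simp add: atLeast0LessThan)
  then show "U \<in> {set (take i xs) | i. i \<le> length xs}" using ile by auto
qed

text \<open>
  The ranking of an enumeration sends a point to its index; conversely a ranking is turned into
  an enumeration by sorting. Rankings are easier to modify than enumerations, which matters for
  the exchange argument below.
\<close>

lemma linear_alignment_iff: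
  assumes "finite X"
  shows "linear_alignment X F \<longleftrightarrow> (\<exists>f. inj_on f X \<and> F = initial_segments X f)"
proof
  assume "linear_alignment X F"
  then obtain xs where xs: "distinct xs" "set xs = X"
    and F: "F = {set (take i xs) | i. i \<le> length xs}"
    unfolding linear_alignment_def by blast
  have bij: "bij_betw ((!) xs) {..<length xs} X"
    using bij_betw_nth[OF xs(1) refl refl] xs(2) by simp
  let ?f = "inv_into {..<length xs} ((!) xs)"
  have "?f (xs ! i) = i" if "i < length xs" for i
    using that bij by (simp add: bij_betw_def inv_into_f_f)
  then have "F = initial_segments X ?f"
    unfolding F by (intro prefixes_eq_initial_segments xs(2)) auto
  moreover have "inj_on ?f X"
    using bij_betw_inv_into[OF bij] by (simp add: bij_betw_def)
  ultimately show "\<exists>f. inj_on f X \<and> F = initial_segments X f" by blast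
next
  assume "\<exists>f. inj_on f X \<and> F = initial_segments X f"
  then obtain f where f: "inj_on f X" and F: "F = initial_segments X f" by blast
  obtain ys where ys: "distinct ys" "set ys = X"
    using finite_distinct_list[OF assms] by blast
  define xs where "xs = sort_key f ys"
  have xs: "distinct xs" "set xs = X" by (simp_all add: xs_def ys)
  have srt: "sorted (map f xs)" by (simp add: xs_def)
  have "f (xs ! i) \<le> f (xs ! j) \<longleftrightarrow> i \<le> j" if ij: "i < length xs" "j < length xs" for i j
  proof
    assume "i \<le> j"
    then show "f (xs ! i) \<le> f (xs ! j)"
      using sorted_nth_mono[OF srt \<open>i \<le> j\<close>] ij by simp
  next
    assume le: "f (xs ! i) \<le> f (xs ! j)"
    show "i \<le> j"
    proof (rule ccontr)
      assume "\<not> i \<le> j"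
      then have "f (xs ! j) \<le> f (xs ! i)"
        using sorted_nth_mono[OF srt, of j i] ij by simp
      with le have "xs ! i = xs ! j"
        using f ij xs(2) by (metis antisym inj_onD nth_mem)
      then show False using \<open>\<not> i \<le> j\<close> xs(1) ij nth_eq_iff_index_eq by fastforce
    qed
  qed
  then have "{set (take i xs) | i. i \<le> length xs} = F"
    unfolding F by (intro prefixes_eq_initial_segments xs(2)) auto
  then show "linear_alignment X F" unfolding linear_alignment_def using xs by blast
qed

lemma initial_segments_nested:
  assumes "U \<in> initial_segments X f" "V \<in> initial_segments X f"
  shows "U \<subseteq> V \<or> V \<subseteq> U"
proof (rule disjCI)
  assume "\<not> V \<subseteq> U"
  then obtain v where v: "v \<in> V" "v \<notin> U" by blast
  show "U \<subseteq> V"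
  proof
    fix u assume u: "u \<in> U"
    then have "\<not> f v \<le> f u" using assms v unfolding initial_segments_def by blast
    then show "u \<in> V" using assms u v unfolding initial_segments_def
      by (smt (verit) mem_Collect_eq nat_le_linear subsetD)
  qed
qed

lemma in_family_sum_iff: "W \<in> family_sum F G \<longleftrightarrow> (\<exists>U\<in>F. \<exists>V\<in>G. W = U \<inter> V)"
  unfolding family_sum_def by blast

lemma upper_bounded_initial_segment:
  "{x\<in>X. \<exists>a\<in>Y. h x \<le> h a} \<in> initial_segments X h"
  unfolding initial_segments_def by (blast intro: order_trans)

lemma family_sum_top: "F \<subseteq> Pow X \<Longrightarrow> family_sum F {X} = F"
  unfolding family_sum_def by (auto simp: Int_absorb2)

lemma family_sum_initial_segments_self:
  "family_sum (initial_segments X f) (initial_segments X f) = initial_segments X f"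
proof
  show "family_sum (initial_segments X f) (initial_segments X f) \<subseteq> initial_segments X f"
    unfolding family_sum_def using initial_segments_nested[of _ X f]
    by (smt (verit) inf.absorb1 inf.absorb2 mem_Collect_eq subsetI)
  show "initial_segments X f \<subseteq> family_sum (initial_segments X f) (initial_segments X f)"
    unfolding family_sum_def by blast
qed


section \<open>Convex dimension two as existence of a realizer\<close>

context convex_geometry
begin

lemma closure_closed: "Y \<subseteq> X \<Longrightarrow> \<phi> Y \<in> closed_sets X \<phi>"
  by (simp add: closed_sets_def idempotent closure_subset)

lemma closure_least: "Y \<subseteq> Z \<Longrightarrow> Z \<in> closed_sets X \<phi> \<Longrightarrow> \<phi> Y \<subseteq> Z"
  unfolding closed_sets_def using monotone by blast

lemma closed_Int:
  assumes "Y \<in> closed_sets X \<phi>" "Z \<in> closed_sets X \<phi>"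
  shows "Y \<inter> Z \<in> closed_sets X \<phi>"
proof -
  have sub: "Y \<inter> Z \<subseteq> X" using assms by (auto simp: closed_sets_def)
  have "\<phi> (Y \<inter> Z) \<subseteq> Y" "\<phi> (Y \<inter> Z) \<subseteq> Z"
    using closure_least assms by auto
  then show ?thesis using sub extensive[OF sub] by (auto simp: closed_sets_def)
qed

lemma top_closed: "X \<in> closed_sets X \<phi>"
  using closure_subset[of X] extensive[of X] by (auto simp: closed_sets_def)

lemma empty_closed: "{} \<in> closed_sets X \<phi>"
  by (simp add: closed_sets_def closure_empty)

text \<open>
  Among the points of \<open>Y - Z\<close> take one for which the closure with \<open>Z\<close> is smallest. A further point
  \<open>z\<close> in this closure would, by anti-exchange, have a strictly smaller closure with \<open>Z\<close>.
\<close>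

lemma closed_extend_by_point:
  assumes Z: "Z \<in> closed_sets X \<phi>" and Y: "Y \<in> closed_sets X \<phi>" and "Z \<subset> Y"
  shows "\<exists>x\<in>Y - Z. insert x Z \<in> closed_sets X \<phi>"
proof -
  have sub: "Z \<subseteq> X" "Y \<subseteq> X" "\<phi> Z = Z" using Z Y by (auto simp: closed_sets_def)
  have "Y - Z \<noteq> {}" using \<open>Z \<subset> Y\<close> by blast
  then obtain x where x: "x \<in> Y - Z"
    and least: "\<And>z. z \<in> Y - Z \<Longrightarrow> card (\<phi> (insert x Z)) \<le> card (\<phi> (insert z Z))"
    using arg_min_if_finite(1)[of "Y - Z" "\<lambda>z. card (\<phi> (insert z Z))"]
      arg_min_least[of "Y - Z" _ "\<lambda>z. card (\<phi> (insert z Z))"]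
      finite_subset[OF sub(2) finite_ground] by (metis finite_Diff)
  let ?C = "\<phi> (insert x Z)"
  have xZ: "insert x Z \<subseteq> X" using x sub by auto
  have CY: "?C \<subseteq> Y" using closure_least[OF _ Y, of "insert x Z"] x \<open>Z \<subset> Y\<close> by auto
  have CX: "?C \<in> closed_sets X \<phi>" using closure_closed[OF xZ] .
  have ext: "insert x Z \<subseteq> ?C" using extensive[OF xZ] .
  have "?C \<subseteq> insert x Z"
  proof (rule ccontr)
    assume "\<not> ?C \<subseteq> insert x Z"
    then obtain z where z: "z \<in> ?C" "z \<noteq> x" "z \<notin> Z" by blast
    have zY: "z \<in> Y - Z" using z CY by auto
    have "x \<notin> \<phi> (insert z Z)"
      using anti_exchange[of Z x z] x z zY sub by auto
    moreover have "\<phi> (insert z Z) \<subseteq> ?C"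
      using closure_least[OF _ CX, of "insert z Z"] z ext by auto
    ultimately have "\<phi> (insert z Z) \<subset> ?C" using ext by blast
    then have "card (\<phi> (insert z Z)) < card ?C"
      using psubset_card_mono finite_subset[OF closure_subset[OF xZ] finite_ground] by blast
    then show False using least[OF zY] by simp
  qed
  then show ?thesis using ext CX x by (metis subset_antisym)
qed

lemma ex_extreme_point:
  assumes U: "U \<in> closed_sets X \<phi>" and "U \<noteq> {}"
  shows "\<exists>x\<in>U. x \<notin> \<phi> (U - {x})"
proof -
  let ?W = "{W \<in> closed_sets X \<phi>. W \<subset> U}"
  have "finite ?W" by (rule finite_subset[of _ "Pow X"]) (auto simp: closed_sets_def finite_ground)
  moreover have "{} \<in> ?W" using empty_closed \<open>U \<noteq> {}\<close> by auto
  ultimately obtain W where W: "W \<in> ?W" and max: "\<And>V. V \<in> ?W \<Longrightarrow> W \<subseteq> V \<Longrightarrow> W = V"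
    using finite_has_maximal[of ?W] by (metis (no_types, lifting) empty_iff)
  obtain x where x: "x \<in> U - W" "insert x W \<in> closed_sets X \<phi>"
    using closed_extend_by_point[of W U] W U by auto
  have "insert x W = U" using max[of "insert x W"] x W by auto
  then have "U - {x} = W" using x by auto
  then show ?thesis using x W by (auto simp: closed_sets_def)
qed

text \<open>
  Enumerations all of whose prefixes are closed are the alignments inside the family of
  closed sets. They can be continued through any larger closed set.
\<close>

lemma chain_of_closed_sets_extends:
  assumes "Y \<in> closed_sets X \<phi>" "distinct xs" "set xs \<subseteq> Y"
    and "\<forall>i. set (take i xs) \<in> closed_sets X \<phi>"
  shows "\<exists>ys. distinct (xs @ ys) \<and> set (xs @ ys) = Y \<and>
           (\<forall>i. set (take i (xs @ ys)) \<in> closed_sets X \<phi>)"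
  using assms(2-4)
proof (induction "card (Y - set xs)" arbitrary: xs rule: less_induct)
  case less
  have fin: "finite Y"
    using assms(1) finite_subset[OF _ finite_ground] by (auto simp: closed_sets_def)
  show ?case
  proof (cases "set xs = Y")
    case True
    then show ?thesis using less.prems by (intro exI[of _ "[]"]) auto
  next
    case False
    have "set xs \<in> closed_sets X \<phi>" using spec[OF less.prems(3), of "length xs"] by simp
    then obtain x where x: "x \<in> Y - set xs" "insert x (set xs) \<in> closed_sets X \<phi>"
      using closed_extend_by_point[OF _ assms(1)] False less.prems by blast
    have "card (Y - set (xs @ [x])) < card (Y - set xs)"
      using x fin by (intro psubset_card_mono) auto
    moreover have "\<forall>i. set (take i (xs @ [x])) \<in> closed_sets X \<phi>"
    proof
      fix i
      show "set (take i (xs @ [x])) \<in> closed_sets X \<phi>"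
        using spec[OF less.prems(3), of i] spec[OF less.prems(3), of "length xs"] x
        by (cases "i \<le> length xs") auto
    qed
    moreover have "distinct (xs @ [x])" "set (xs @ [x]) \<subseteq> Y"
      using x less.prems by auto
    ultimately obtain ys where "distinct ((xs @ [x]) @ ys) \<and> set ((xs @ [x]) @ ys) = Y \<and>
        (\<forall>i. set (take i ((xs @ [x]) @ ys)) \<in> closed_sets X \<phi>)"
      using less.hyps[of "xs @ [x]"] by meson
    then show ?thesis by (intro exI[of _ "x # ys"]) simp
  qed
qed

lemma ex_alignment_through_closed_set:
  assumes Y: "Y \<in> closed_sets X \<phi>"
  shows "\<exists>F. linear_alignment X F \<and> F \<subseteq> closed_sets X \<phi> \<and> Y \<in> F"
proof -
  obtain xs where xs: "distinct xs" "set xs = Y" "\<forall>i. set (take i xs) \<in> closed_sets X \<phi>"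
    using chain_of_closed_sets_extends[OF Y, of "[]"] empty_closed by auto
  obtain ys where ys: "distinct (xs @ ys)" "set (xs @ ys) = X"
      "\<forall>i. set (take i (xs @ ys)) \<in> closed_sets X \<phi>"
    using chain_of_closed_sets_extends[OF top_closed, of xs] xs Y by (auto simp: closed_sets_def)
  let ?F = "{set (take i (xs @ ys)) | i. i \<le> length (xs @ ys)}"
  have "Y \<in> ?F" using xs by (intro CollectI exI[of _ "length xs"]) auto
  moreover have "linear_alignment X ?F" unfolding linear_alignment_def using ys by blast
  ultimately show ?thesis using ys by blast
qed

text \<open>
  The convex dimension is defined as a least number, so it carries information only if some sum of
  alignments is the family of closed sets. All alignments that consist of closed sets do
  together: every closed set is a member of one of them, and all of them contain \<open>X\<close>.
\<close>

lemma ex_alignment_sum: "\<exists>Fs. is_alignment_sum X \<phi> Fs"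
proof -
  let ?A = "{F. linear_alignment X F \<and> F \<subseteq> closed_sets X \<phi>}"
  have "finite ?A"
    by (rule finite_subset[of _ "Pow (Pow X)"]) (auto simp: closed_sets_def finite_ground)
  then have "\<exists>Fs. set Fs = ?A" by (rule finite_list)
  then obtain Fs where Fs: "set Fs = ?A" by (rule exE)
  have sub: "set Gs \<subseteq> ?A \<Longrightarrow> foldr family_sum Gs {X} \<subseteq> closed_sets X \<phi>" for Gs
  proof (induction Gs)
    case (Cons G Gs)
    then have "G \<subseteq> closed_sets X \<phi>" "foldr family_sum Gs {X} \<subseteq> closed_sets X \<phi>" by auto
    then show ?case by (auto simp: in_family_sum_iff intro!: closed_Int)
  qed (simp add: top_closed)
  have X_in: "X \<in> F" if F: "linear_alignment X F" for F
  proof -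
    obtain xs where "set xs = X" "F = {set (take i xs) | i. i \<le> length xs}"
      using F unfolding linear_alignment_def by blast
    then show ?thesis by (auto intro!: exI[of _ "length xs"])
  qed
  have top: "set Gs \<subseteq> ?A \<Longrightarrow> X \<in> foldr family_sum Gs {X}" for Gs
  proof (induction Gs)
    case (Cons G Gs)
    then show ?case using X_in[of G] by (auto simp: in_family_sum_iff intro!: bexI[of _ X])
  qed simp
  have mem: "set Gs \<subseteq> ?A \<Longrightarrow> G \<in> set Gs \<Longrightarrow> Y \<in> G \<Longrightarrow> Y \<subseteq> X \<Longrightarrow> Y \<in> foldr family_sum Gs {X}" for Gs G Y
  proof (induction Gs)
    case (Cons H Gs)
    show ?case
    proof (cases "G = H")
      case True
      then show ?thesis using Cons.prems top[of Gs]
        unfolding foldr.simps o_apply in_family_sum_iff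
        by (intro bexI[of _ Y] bexI[of _ X]) auto
    next
      case False
      then have "Y \<in> foldr family_sum Gs {X}" using Cons by auto
      moreover have "X \<in> H" using X_in Cons.prems by auto
      ultimately show ?thesis using Cons.prems
        unfolding foldr.simps o_apply in_family_sum_iff
        by (intro bexI[of _ X] bexI[of _ Y]) auto
    qed
  qed simp
  have "closed_sets X \<phi> \<subseteq> foldr family_sum Fs {X}"
  proof
    fix Y assume Y: "Y \<in> closed_sets X \<phi>"
    obtain F where "F \<in> ?A" "Y \<in> F" using ex_alignment_through_closed_set[OF Y] by blast
    then show "Y \<in> foldr family_sum Fs {X}" using mem[of Fs F Y] Fs Y by (auto simp: closed_sets_def)
  qed
  moreover have "Fs \<noteq> []" using ex_alignment_through_closed_set[OF top_closed] Fs by auto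
  ultimately have "is_alignment_sum X \<phi> Fs"
    unfolding is_alignment_sum_def using sub[of Fs] Fs by auto
  then show ?thesis by blast
qed

text \<open>
  The points bounded by \<open>Y\<close> under a ranking form the least initial segment containing \<open>Y\<close>, so
  the closure formula says that the least member of the sum above \<open>Y\<close> is \<open>\<phi> Y\<close>.
\<close>

lemma realizer_iff_family_sum:
  "realizer X \<phi> f g \<longleftrightarrow> inj_on f X \<and> inj_on g X \<and>
     family_sum (initial_segments X f) (initial_segments X g) = closed_sets X \<phi>"
  (is "?R \<longleftrightarrow> ?S")
proof
  assume R: ?R
  have sub: "U \<inter> V \<in> closed_sets X \<phi>"
    if U: "U \<in> initial_segments X f" and V: "V \<in> initial_segments X g" for U V
  proof (cases "U \<inter> V = {}")
    case True
    then show ?thesis using empty_closed by simp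
  next
    case False
    have s: "U \<inter> V \<subseteq> X" using U by (auto simp: initial_segments_def)
    then have "\<phi> (U \<inter> V) = {x\<in>X. (\<exists>a\<in>U \<inter> V. f x \<le> f a) \<and> (\<exists>b\<in>U \<inter> V. g x \<le> g b)}"
      using R False unfolding realizer_def by blast
    also have "\<dots> \<subseteq> U \<inter> V" using U V unfolding initial_segments_def by blast
    finally show ?thesis using extensive[OF s] s by (auto simp: closed_sets_def)
  qed
  have sup: "Y \<in> family_sum (initial_segments X f) (initial_segments X g)"
    if Y: "Y \<in> closed_sets X \<phi>" for Y
  proof -
    note seg = upper_bounded_initial_segment[of X Y]
    have "Y = {x\<in>X. \<exists>a\<in>Y. f x \<le> f a} \<inter> {x\<in>X. \<exists>b\<in>Y. g x \<le> g b}"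
    proof (cases "Y = {}")
      case False
      then have "\<phi> Y = {x\<in>X. (\<exists>a\<in>Y. f x \<le> f a) \<and> (\<exists>b\<in>Y. g x \<le> g b)}"
        using R Y unfolding realizer_def closed_sets_def by blast
      then show ?thesis using Y by (auto simp: closed_sets_def)
    qed simp
    then show ?thesis unfolding in_family_sum_iff using seg by blast
  qed
  have "family_sum (initial_segments X f) (initial_segments X g) = closed_sets X \<phi>"
  proof
    show "family_sum (initial_segments X f) (initial_segments X g) \<subseteq> closed_sets X \<phi>"
      by (auto simp: in_family_sum_iff intro: sub)
  qed (use sup in blast)
  then show ?S using R unfolding realizer_def by simp
next
  assume S: ?S
  then have sum: "family_sum (initial_segments X f) (initial_segments X g) = closed_sets X \<phi>"
    by blast
  have "\<phi> Y = {x\<in>X. (\<exists>a\<in>Y. f x \<le> f a) \<and> (\<exists>b\<in>Y. g x \<le> g b)}" (is "_ = ?H")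
    if Y: "Y \<subseteq> X" for Y
  proof
    note seg = upper_bounded_initial_segment[of X Y]
    have "?H = {x\<in>X. \<exists>a\<in>Y. f x \<le> f a} \<inter> {x\<in>X. \<exists>b\<in>Y. g x \<le> g b}" by blast
    then have "?H \<in> family_sum (initial_segments X f) (initial_segments X g)"
      unfolding in_family_sum_iff using seg[of f] seg[of g] by blast
    then have H: "?H \<in> closed_sets X \<phi>" unfolding sum .
    have "Y \<subseteq> ?H" using Y by auto
    then show "\<phi> Y \<subseteq> ?H" using H by (rule closure_least)
  next
    have "\<phi> Y \<in> family_sum (initial_segments X f) (initial_segments X g)"
      unfolding sum using closure_closed[OF Y] .
    then obtain U V where U: "U \<in> initial_segments X f" and V: "V \<in> initial_segments X g"
      and UV: "\<phi> Y = U \<inter> V" unfolding in_family_sum_iff by blast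
    show "?H \<subseteq> \<phi> Y"
    proof
      fix x assume "x \<in> ?H"
      then obtain a b where ab: "a \<in> Y" "b \<in> Y" and x: "x \<in> X" "f x \<le> f a" "g x \<le> g b"
        by auto
      have "a \<in> U" "b \<in> V" using extensive[OF Y] ab UV by auto
      then have "x \<in> U" "x \<in> V" using x U V unfolding initial_segments_def by blast+
      then show "x \<in> \<phi> Y" using UV by simp
    qed
  qed
  then show ?R unfolding realizer_def using S by simp
qed

lemma alignment_family_sum_top:
  assumes "linear_alignment X F"
  shows "family_sum F {X} = F"
proof (rule family_sum_top)
  show "F \<subseteq> Pow X" using assms unfolding linear_alignment_iff[OF finite_ground]
    by (auto simp: initial_segments_def)
qed

lemma alignment_sum_of_two:
  "(\<exists>Fs. length Fs = 2 \<and> is_alignment_sum X \<phi> Fs) \<longleftrightarrow> (\<exists>f g. realizer X \<phi> f g)"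
proof -
  have pair: "is_alignment_sum X \<phi> [F, G] \<longleftrightarrow>
      linear_alignment X F \<and> linear_alignment X G \<and> family_sum F G = closed_sets X \<phi>" for F G
    using alignment_family_sum_top[of G] by (auto simp: is_alignment_sum_def)
  have "(\<exists>Fs. length Fs = 2 \<and> is_alignment_sum X \<phi> Fs) \<longleftrightarrow>
      (\<exists>F G. is_alignment_sum X \<phi> [F, G])"
    by (auto simp: numeral_2_eq_2 length_Suc_conv)
  also have "\<dots> \<longleftrightarrow> (\<exists>f g. realizer X \<phi> f g)"
    unfolding pair linear_alignment_iff[OF finite_ground] realizer_iff_family_sum by metis
  finally show ?thesis .
qed

text \<open>
  A chain is the sum of itself with itself, so one alignment is two equal ones.
\<close>

lemma alignment_sum_of_one:
  "(\<exists>Fs. length Fs = 1 \<and> is_alignment_sum X \<phi> Fs) \<longleftrightarrow> (\<exists>f. realizer X \<phi> f f)"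
proof -
  have single: "is_alignment_sum X \<phi> [F] \<longleftrightarrow> linear_alignment X F \<and> F = closed_sets X \<phi>" for F
    using alignment_family_sum_top[of F] by (auto simp: is_alignment_sum_def)
  have "(\<exists>Fs. length Fs = 1 \<and> is_alignment_sum X \<phi> Fs) \<longleftrightarrow> (\<exists>F. is_alignment_sum X \<phi> [F])"
    by (auto simp: length_Suc_conv)
  also have "\<dots> \<longleftrightarrow> (\<exists>f. realizer X \<phi> f f)"
    unfolding single linear_alignment_iff[OF finite_ground] realizer_iff_family_sum
      family_sum_initial_segments_self by metis
  finally show ?thesis .
qed

lemma cdim_eq_2_iff:
  "cdim X \<phi> = 2 \<longleftrightarrow> (\<exists>f g. realizer X \<phi> f g) \<and> \<not> (\<exists>f. realizer X \<phi> f f)"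
proof -
  let ?P = "\<lambda>d. \<exists>Fs. length Fs = d \<and> is_alignment_sum X \<phi> Fs"
  obtain Fs where "is_alignment_sum X \<phi> Fs" using ex_alignment_sum ..
  then have "?P (length Fs)" by (intro exI[of _ Fs] conjI refl)
  then have ex: "?P (LEAST d. ?P d)" by (rule LeastI)
  have P0: "\<not> ?P 0" by (auto simp: is_alignment_sum_def)
  have "(LEAST d. ?P d) = 2 \<longleftrightarrow> ?P 2 \<and> \<not> ?P 1"
  proof
    assume L: "(LEAST d. ?P d) = 2"
    have "?P 2" using ex unfolding L .
    moreover have "\<not> ?P 1" by (rule not_less_Least) (simp add: L)
    ultimately show "?P 2 \<and> \<not> ?P 1" by (rule conjI)
  next
    assume P: "?P 2 \<and> \<not> ?P 1"
    show "(LEAST d. ?P d) = 2"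
    proof (rule Least_equality)
      show "?P 2" using P by blast
      fix d assume "?P d"
      then have "d \<noteq> 0" "d \<noteq> 1" using P P0 by blast+
      then show "2 \<le> d" by simp
    qed
  qed
  then show ?thesis unfolding cdim_def alignment_sum_of_one alignment_sum_of_two .
qed

end


section \<open>Greedy peeling of two rankings\<close>

definition remaining :: "'a set \<Rightarrow> ('a \<Rightarrow> nat) \<Rightarrow> 'a set" where
  "remaining X f = {x\<in>X. f x = 0}"

definition extreme :: "('a set \<Rightarrow> 'a set) \<Rightarrow> 'a set \<Rightarrow> 'a \<Rightarrow> bool" where
  "extreme \<phi> U x \<longleftrightarrow> x \<in> U \<and> x \<notin> \<phi> (U - {x})"

text \<open>
  Rank \<open>0\<close> stands for a point without a rank. If there are two extreme points and the maximum of the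
  other order is already ranked there, then minimality of \<open>g c\<close> avoids it.
\<close>

definition greedy_choice ::
  "'a set \<Rightarrow> ('a set \<Rightarrow> 'a set) \<Rightarrow> ('a \<Rightarrow> nat) \<Rightarrow> ('a \<Rightarrow> nat) \<Rightarrow> 'a \<Rightarrow> bool" where
  "greedy_choice X \<phi> f g c \<longleftrightarrow> extreme \<phi> (remaining X f) c \<and>
     (\<forall>x. extreme \<phi> (remaining X f) x \<longrightarrow> g c \<le> g x)"

text \<open>
  In \<open>peeling X \<phi> v f g\<close> there are \<open>v\<close> rounds left. Ranks are given out from \<open>card X\<close> downwards, so
  that higher points are removed earlier, and the second choice of a round already sees the
  first one.
\<close>

inductive peeling ::
  "'a set \<Rightarrow> ('a set \<Rightarrow> 'a set) \<Rightarrow> nat \<Rightarrow> ('a \<Rightarrow> nat) \<Rightarrow> ('a \<Rightarrow> nat) \<Rightarrow> bool" for X \<phi> where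
  start: "peeling X \<phi> (card X) (\<lambda>_. 0) (\<lambda>_. 0)"
| round: "\<lbrakk>peeling X \<phi> (Suc v) f g; greedy_choice X \<phi> f g c;
    greedy_choice X \<phi> g (f(c := Suc v)) d\<rbrakk>
    \<Longrightarrow> peeling X \<phi> v (f(c := Suc v)) (g(d := Suc v))"

text \<open>
  The initial segments at levels from \<open>v\<close> upwards are final: later rounds only
  distinguish points inside the set of remaining points.
\<close>

definition ranked_down_to ::
  "'a set \<Rightarrow> ('a set \<Rightarrow> 'a set) \<Rightarrow> nat \<Rightarrow> ('a \<Rightarrow> nat) \<Rightarrow> bool" where
  "ranked_down_to X \<phi> v f \<longleftrightarrow>
     inj_on f (X - remaining X f) \<and> f ` (X - remaining X f) \<subseteq> {v<..card X} \<and>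
     card (remaining X f) = v \<and> (\<forall>w\<ge>v. {x\<in>X. f x \<le> w} \<in> closed_sets X \<phi>)"

text \<open>
  Agreement of a partial ranking \<open>f\<close> with an order \<open>F\<close>: the ranked points are ordered as by \<open>F\<close> and
  lie above all remaining points, since those have \<open>f\<close>-value \<open>0\<close>.
\<close>

definition refines :: "'a set \<Rightarrow> ('a \<Rightarrow> nat) \<Rightarrow> ('a \<Rightarrow> nat) \<Rightarrow> bool" where
  "refines X f F \<longleftrightarrow> (\<forall>x\<in>X. \<forall>y\<in>X. f x < f y \<longrightarrow> F x < F y)"

lemma finite_has_maximum:
  fixes h :: "'a \<Rightarrow> nat"
  assumes "finite U" "U \<noteq> {}"
  shows "\<exists>p\<in>U. \<forall>x\<in>U. h x \<le> h p"
proof -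
  have "Max (h ` U) \<in> h ` U" using assms by simp
  then obtain p where "p \<in> U" "h p = Max (h ` U)" by auto
  then show ?thesis using assms(1) by (intro bexI[of _ p]) auto
qed

lemma realizer_sym: "realizer X \<phi> f g \<Longrightarrow> realizer X \<phi> g f"
  unfolding realizer_def by blast

lemma realizerD:
  assumes "realizer X \<phi> f g" "Y \<subseteq> X" "Y \<noteq> {}"
  shows "x \<in> \<phi> Y \<longleftrightarrow> x \<in> X \<and> (\<exists>a\<in>Y. f x \<le> f a) \<and> (\<exists>b\<in>Y. g x \<le> g b)"
proof -
  have "\<phi> Y = {x\<in>X. (\<exists>a\<in>Y. f x \<le> f a) \<and> (\<exists>b\<in>Y. g x \<le> g b)}"
    using assms unfolding realizer_def by simp
  then show ?thesis by simp
qed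

text \<open>
  If \<open>U\<close> is an initial segment of both orders, then the bounds that a set \<open>Y\<close> imposes inside \<open>U\<close>
  are either those of both orders, when \<open>Y \<subseteq> U\<close>, or void. So the two orders may be exchanged on
  \<open>U\<close> without changing the closure operator that they describe.
\<close>

lemma realizer_swap_below:
  assumes fin: "finite X" and R: "realizer X \<phi> F G" and U: "U \<subseteq> X"
    and down: "\<forall>x\<in>U. \<forall>y\<in>X - U. F x < F y \<and> G x < G y"
  shows "\<exists>F' G'. realizer X \<phi> F' G' \<and> (\<forall>x\<in>U. \<forall>y\<in>U. F' x < F' y \<longleftrightarrow> G x < G y) \<and>
    (\<forall>x\<in>X - U. \<forall>y\<in>X - U. (F' x < F' y \<longleftrightarrow> F x < F y) \<and> (G' x < G' y \<longleftrightarrow> G x < G y)) \<and>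
    (\<forall>x\<in>U. \<forall>y\<in>X - U. F' x < F' y \<and> G' x < G' y)"
proof -
  \<comment> \<open>The values outside \<open>U\<close> are shifted by \<open>K\<close>, which exceeds all values, so that they stay above
    the values on \<open>U\<close> when the latter come from the other order.\<close>
  define K where "K = Suc (\<Sum>x\<in>X. F x + G x)"
  have K: "F x < K" "G x < K" if "x \<in> X" for x
    using member_le_sum[of x X "\<lambda>x. F x + G x"] that fin unfolding K_def by auto
  define splice where "splice A B = (\<lambda>x. if x \<in> U then A x else B x + K)" for A B :: "'a \<Rightarrow> nat"
  have inj: "inj_on (splice A B) X" if "inj_on A X" "inj_on B X" "\<And>x. x \<in> X \<Longrightarrow> A x < K" for A B
  proof (rule inj_onI)
    fix x y assume "x \<in> X" "y \<in> X" "splice A B x = splice A B y"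
    then show "x = y"
      using inj_onD[OF that(1), of x y] inj_onD[OF that(2), of x y] that(3)[of x] that(3)[of y]
      by (auto simp: splice_def split: if_splits)
  qed
  have bound: "(\<exists>a\<in>Y. splice A B x \<le> splice A B a) \<longleftrightarrow>
      (if Y \<subseteq> U then \<exists>a\<in>Y. A x \<le> A a else \<exists>a\<in>Y. B x \<le> B a)"
    if Y: "Y \<subseteq> X" and x: "x \<in> X" and A: "\<And>x. x \<in> X \<Longrightarrow> A x < K"
      and dA: "\<And>x y. x \<in> U \<Longrightarrow> y \<in> X - U \<Longrightarrow> A x < A y"
      and dB: "\<And>x y. x \<in> U \<Longrightarrow> y \<in> X - U \<Longrightarrow> B x < B y" for A B Y x
  proof (cases "Y \<subseteq> U")
    case True
    have "splice A B x \<le> splice A B a \<longleftrightarrow> A x \<le> A a" if "a \<in> Y" for a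
      using that True x dA[of a x] A[of a] U by (auto simp: splice_def)
    then show ?thesis using True by auto
  next
    case False
    then obtain z where z: "z \<in> Y" "z \<notin> U" by blast
    have zX: "z \<in> X" using z Y by blast
    show ?thesis
    proof (cases "x \<in> U")
      case True
      have "splice A B x \<le> splice A B z" "B x \<le> B z"
        using True z zX A[OF x] dB[of x z] by (auto simp: splice_def)
      then show ?thesis using False z by auto
    next
      case xU: False
      have "splice A B x \<le> splice A B a \<longleftrightarrow> B x \<le> B a" if "a \<in> Y" for a
        using that x xU Y dB[of a x] A[of a] by (auto simp: splice_def)
      then show ?thesis using False by auto
    qed
  qed
  let ?F = "splice G F" and ?G = "splice F G"
  have "realizer X \<phi> ?F ?G"
    unfolding realizer_def
  proof (intro conjI allI impI)
    show "inj_on ?F X" "inj_on ?G X"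
      using R K by (auto simp: realizer_def intro!: inj)
    fix Y assume Y: "Y \<subseteq> X" "Y \<noteq> {}"
    have "x \<in> \<phi> Y \<longleftrightarrow> x \<in> X \<and> (\<exists>a\<in>Y. ?F x \<le> ?F a) \<and> (\<exists>b\<in>Y. ?G x \<le> ?G b)" for x
    proof (cases "x \<in> X")
      case True
      have "(\<exists>a\<in>Y. ?F x \<le> ?F a) \<longleftrightarrow> (if Y \<subseteq> U then \<exists>a\<in>Y. G x \<le> G a else \<exists>a\<in>Y. F x \<le> F a)"
        by (rule bound) (use Y True K down in auto)
      moreover have "(\<exists>a\<in>Y. ?G x \<le> ?G a) \<longleftrightarrow>
          (if Y \<subseteq> U then \<exists>a\<in>Y. F x \<le> F a else \<exists>a\<in>Y. G x \<le> G a)"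
        by (rule bound) (use Y True K down in auto)
      ultimately show ?thesis using realizerD[OF R Y, of x] True by auto
    qed (use realizerD[OF R Y] in blast)
    then show "\<phi> Y = {x\<in>X. (\<exists>a\<in>Y. ?F x \<le> ?F a) \<and> (\<exists>b\<in>Y. ?G x \<le> ?G b)}" by blast
  qed
  then show ?thesis
    using U K by (intro exI[of _ ?F] exI[of _ ?G]) (auto simp: splice_def trans_less_add2)
qed

context convex_geometry
begin

lemma remaining_subset: "remaining X f \<subseteq> X"
  by (auto simp: remaining_def)

lemma ranked_start: "ranked_down_to X \<phi> (card X) (\<lambda>_. 0)"
  using top_closed by (auto simp: ranked_down_to_def remaining_def)

lemma ranked_remaining_closed:
  assumes "ranked_down_to X \<phi> v f"
  shows "remaining X f \<in> closed_sets X \<phi>"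
proof -
  have "remaining X f = {x\<in>X. f x \<le> v}"
    using assms by (fastforce simp: ranked_down_to_def remaining_def)
  then show ?thesis using assms by (simp add: ranked_down_to_def)
qed

text \<open>
  Removing an extreme point from a closed set leaves a closed set, so peeling keeps all initial
  segments closed, whether or not a realizer exists.
\<close>

lemma ranked_peel:
  assumes f: "ranked_down_to X \<phi> (Suc v) f" and c: "extreme \<phi> (remaining X f) c"
  shows "ranked_down_to X \<phi> v (f(c := Suc v))"
proof -
  let ?U = "remaining X f" and ?f = "f(c := Suc v)"
  have cU: "c \<in> ?U" "c \<in> X" "f c = 0" using c by (auto simp: extreme_def remaining_def)
  have rem: "remaining X ?f = ?U - {c}" by (auto simp: remaining_def)
  have ranked: "X - remaining X ?f = insert c (X - ?U)" using cU by (auto simp: rem)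
  have above: "Suc v < f x \<and> f x \<le> card X" if "x \<in> X - ?U" for x
    using f that by (auto simp: ranked_down_to_def)
  have "Suc v \<le> card X"
    using f card_mono[OF finite_ground remaining_subset[of f]] by (simp add: ranked_down_to_def)
  then have "?f ` (X - remaining X ?f) \<subseteq> {v<..card X}"
    unfolding ranked using above cU by fastforce
  moreover have "inj_on ?f (X - remaining X ?f)"
  proof -
    have "inj_on f (X - ?U)" using f by (simp add: ranked_down_to_def)
    then have "inj_on ?f (X - ?U)" using above by (intro inj_on_fun_updI) force+
    moreover have "Suc v \<notin> ?f ` (X - ?U)"
    proof
      assume "Suc v \<in> ?f ` (X - ?U)"
      then obtain x where "x \<in> X - ?U" "?f x = Suc v" by (metis imageE)
      then show False using above[of x] cU by (auto split: if_splits)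
    qed
    ultimately show ?thesis unfolding ranked by auto
  qed
  moreover have "card (remaining X ?f) = v"
    using f cU finite_subset[OF remaining_subset finite_ground] by (simp add: rem ranked_down_to_def)
  moreover have "{x\<in>X. ?f x \<le> w} \<in> closed_sets X \<phi>" if "v \<le> w" for w
  proof (cases "w = v")
    case True
    have "{x\<in>X. ?f x \<le> v} = ?U - {c}"
    proof -
      have "?f x \<le> v \<longleftrightarrow> f x = 0 \<and> x \<noteq> c" if "x \<in> X" for x
        using above[of x] that by (cases "f x = 0") (auto simp: remaining_def)
      then show ?thesis by (auto simp: remaining_def simp del: fun_upd_apply)
    qed
    moreover have "?U - {c} \<in> closed_sets X \<phi>"
    proof -
      have sub: "?U - {c} \<subseteq> X" using remaining_subset by blast
      have "\<phi> (?U - {c}) \<subseteq> ?U" using closure_least[OF _ ranked_remaining_closed[OF f]] by blast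
      then have "\<phi> (?U - {c}) \<subseteq> ?U - {c}" using c by (auto simp: extreme_def)
      then show ?thesis using extensive[OF sub] sub by (auto simp: closed_sets_def)
    qed
    ultimately show ?thesis using True by simp
  next
    case False
    then have "{x\<in>X. ?f x \<le> w} = {x\<in>X. f x \<le> w}" using that cU by auto
    then show ?thesis using f that False by (simp add: ranked_down_to_def)
  qed
  ultimately show ?thesis by (simp add: ranked_down_to_def)
qed

lemma ex_greedy_choice:
  assumes "ranked_down_to X \<phi> (Suc v) f"
  shows "\<exists>c. greedy_choice X \<phi> f g c"
proof -
  have "remaining X f \<noteq> {}" using assms by (auto simp: ranked_down_to_def)
  then have "\<exists>x. extreme \<phi> (remaining X f) x"
    using ex_extreme_point[OF ranked_remaining_closed[OF assms]] by (auto simp: extreme_def)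
  then show ?thesis unfolding greedy_choice_def using ex_has_least_nat[of _ _ g] by metis
qed

lemma peeling_ranked:
  "peeling X \<phi> v f g \<Longrightarrow> ranked_down_to X \<phi> v f \<and> ranked_down_to X \<phi> v g"
  by (induction rule: peeling.induct)
     (simp_all add: greedy_choice_def ranked_start ranked_peel del: fun_upd_apply)

lemma ranked_0_inj: "ranked_down_to X \<phi> 0 f \<Longrightarrow> inj_on f X"
  using finite_subset[OF remaining_subset[of f] finite_ground]
  by (auto simp: ranked_down_to_def)

text \<open>
  A complete ranking is determined by the order it induces.
\<close>

lemma ranked_0_eq_card:
  assumes "ranked_down_to X \<phi> 0 f" "x \<in> X"
  shows "f x = card {y\<in>X. f y \<le> f x}"
proof -
  have inj: "inj_on f X" using ranked_0_inj[OF assms(1)] .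
  have "f ` X \<subseteq> {1..card X}"
    using assms(1) finite_subset[OF remaining_subset finite_ground] by (force simp: ranked_down_to_def)
  then have onto: "f ` X = {1..card X}"
    by (rule card_subset_eq[rotated]) (simp_all add: card_image[OF inj])
  have "f ` {y\<in>X. f y \<le> f x} = {1..f x}"
  proof
    show "f ` {y\<in>X. f y \<le> f x} \<subseteq> {1..f x}" using onto by auto
    show "{1..f x} \<subseteq> f ` {y\<in>X. f y \<le> f x}"
    proof
      fix i assume i: "i \<in> {1..f x}"
      moreover have "f x \<le> card X" using onto assms(2) by auto
      ultimately have "i \<in> f ` X" unfolding onto by simp
      then show "i \<in> f ` {y\<in>X. f y \<le> f x}" using i by auto
    qed
  qed
  moreover have "inj_on f {y\<in>X. f y \<le> f x}" using inj by (rule inj_on_subset) auto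
  ultimately show ?thesis using card_image by fastforce
qed

lemma closure_below_ranking:
  assumes "ranked_down_to X \<phi> 0 f" "Y \<subseteq> X" "x \<in> \<phi> Y" "Y \<noteq> {}"
  shows "\<exists>a\<in>Y. f x \<le> f a"
proof -
  have fin: "finite Y" using assms(2) finite_ground finite_subset by blast
  let ?S = "{x\<in>X. f x \<le> Max (f ` Y)}"
  have "?S \<in> closed_sets X \<phi>" using assms(1) by (simp add: ranked_down_to_def)
  moreover have "Y \<subseteq> ?S" using assms(2) fin by auto
  ultimately have "x \<in> ?S" using closure_least assms(3) by blast
  moreover have "Max (f ` Y) \<in> f ` Y" using fin assms(4) by simp
  ultimately show ?thesis by auto
qed

text \<open>
  One inclusion of the closure formula holds because the initial segments are closed. For
  the other one, a point bounded by \<open>a \<in> Y\<close> and by \<open>b \<in> Y\<close> already lies in \<open>\<phi> {a, b} \<subseteq> \<phi> Y\<close>.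
\<close>

lemma realizer_iff_pairs:
  assumes f: "ranked_down_to X \<phi> 0 f" and g: "ranked_down_to X \<phi> 0 g"
  shows "realizer X \<phi> f g \<longleftrightarrow>
    (\<forall>a\<in>X. \<forall>b\<in>X. \<forall>x\<in>X. f x \<le> f a \<longrightarrow> g x \<le> g b \<longrightarrow> x \<in> \<phi> {a, b})"
proof
  assume "realizer X \<phi> f g"
  then show "\<forall>a\<in>X. \<forall>b\<in>X. \<forall>x\<in>X. f x \<le> f a \<longrightarrow> g x \<le> g b \<longrightarrow> x \<in> \<phi> {a, b}"
    using realizerD[of X \<phi> f g] by simp
next
  assume pairs: "\<forall>a\<in>X. \<forall>b\<in>X. \<forall>x\<in>X. f x \<le> f a \<longrightarrow> g x \<le> g b \<longrightarrow> x \<in> \<phi> {a, b}"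
  have "\<phi> Y = {x\<in>X. (\<exists>a\<in>Y. f x \<le> f a) \<and> (\<exists>b\<in>Y. g x \<le> g b)}" (is "_ = ?H")
    if Y: "Y \<subseteq> X" "Y \<noteq> {}" for Y
  proof
    show "\<phi> Y \<subseteq> ?H"
      using closure_below_ranking[OF f Y(1) _ Y(2)] closure_below_ranking[OF g Y(1) _ Y(2)]
        closure_subset[OF Y(1)] by auto
    show "?H \<subseteq> \<phi> Y"
    proof
      fix x assume "x \<in> ?H"
      then obtain a b where ab: "a \<in> Y" "b \<in> Y" and x: "x \<in> X" "f x \<le> f a" "g x \<le> g b" by auto
      have "x \<in> \<phi> {a, b}" using pairs ab x Y by auto
      moreover have "\<phi> {a, b} \<subseteq> \<phi> Y" using ab Y by (intro monotone) auto
      ultimately show "x \<in> \<phi> Y" by blast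
    qed
  qed
  then show "realizer X \<phi> f g"
    unfolding realizer_def using ranked_0_inj[OF f] ranked_0_inj[OF g] by simp
qed

text \<open>
  A point of \<open>U\<close> that is exceeded by some point in each of the two orders is in the closure of
  these points.
\<close>

lemma extreme_is_maximum:
  assumes R: "realizer X \<phi> F G" and U: "U \<subseteq> X" and c: "extreme \<phi> U c"
  shows "(\<forall>x\<in>U. F x \<le> F c) \<or> (\<forall>x\<in>U. G x \<le> G c)"
proof (rule ccontr)
  assume "\<not> ?thesis"
  then obtain p q where pq: "p \<in> U" "F c < F p" "q \<in> U" "G c < G q" by (auto simp: not_le)
  then have "p \<in> U - {c}" "q \<in> U - {c}" by auto
  then have "c \<in> \<phi> (U - {c})"
    using realizerD[OF R, of "U - {c}" c] U c pq by (auto simp: extreme_def intro: less_imp_le)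
  then show False using c by (simp add: extreme_def)
qed

lemma maximum_is_extreme:
  assumes R: "realizer X \<phi> F G" and U: "U \<subseteq> X" and c: "c \<in> U" "\<And>x. x \<in> U \<Longrightarrow> F x \<le> F c"
  shows "extreme \<phi> U c"
proof -
  have "c \<notin> \<phi> (U - {c})"
  proof
    assume mem: "c \<in> \<phi> (U - {c})"
    then have "U - {c} \<noteq> {}" using closure_empty by (metis empty_iff)
    then obtain a where "a \<in> U - {c}" "F c \<le> F a"
      using realizerD[OF R, of "U - {c}" c] mem U by auto
    moreover have "inj_on F X" using R by (simp add: realizer_def)
    ultimately show False using c U by (metis Diff_iff antisym inj_onD insertI1 subsetD)
  qed
  then show ?thesis using c by (simp add: extreme_def)
qed

lemma refines_peel:
  assumes "refines X f F" "inj_on F X" "ranked_down_to X \<phi> (Suc v) f"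
    and c: "c \<in> remaining X f" "\<And>x. x \<in> remaining X f \<Longrightarrow> F x \<le> F c"
  shows "refines X (f(c := Suc v)) F"
  unfolding refines_def
proof (intro ballI impI)
  fix x y assume xy: "x \<in> X" "y \<in> X" "(f(c := Suc v)) x < (f(c := Suc v)) y"
  have cX: "c \<in> X" "f c = 0" using c by (auto simp: remaining_def)
  have above: "f z = 0 \<or> Suc v < f z" if "z \<in> X" for z
  proof (cases "z \<in> remaining X f")
    case False
    then have "f z \<in> f ` (X - remaining X f)" using that by blast
    then show ?thesis using assms(3) by (auto simp: ranked_down_to_def)
  qed (simp add: remaining_def)
  consider "x = c" "y \<noteq> c" | "x \<noteq> c" "y = c" | "x \<noteq> c" "y \<noteq> c" using xy by auto
  then show "F x < F y"
  proof cases
    case 2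
    then have "f x = 0" using above[OF xy(1)] xy(3) by auto
    then have "F x \<le> F c" using c xy by (simp add: remaining_def)
    moreover have "F x \<noteq> F c" using assms(2) 2 cX xy by (auto dest: inj_onD)
    ultimately show ?thesis using 2 by simp
  qed (use assms(1) xy cX in \<open>auto simp: refines_def\<close>)
qed

text \<open>
  The heart of the search. If the chosen point \<open>c\<close> is the maximum of the remaining set under \<open>F\<close>,
  then \<open>f\<close> follows \<open>F\<close>. Otherwise \<open>c\<close> is the maximum under \<open>G\<close>, and the choice rule forces it to be
  unranked in \<open>g\<close>. Then all remaining points are unranked in \<open>g\<close> as well, and the bound on
  \<open>w\<close> makes both remaining sets equal, so that the orders can be exchanged on this set.
\<close>

lemma greedy_choice_keeps_realizer:
  assumes R: "realizer X \<phi> F G" and fF: "refines X f F" and gG: "refines X g G"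
    and f: "ranked_down_to X \<phi> (Suc v) f" and g: "ranked_down_to X \<phi> w g"
    and w: "w \<le> Suc v" and c: "greedy_choice X \<phi> f g c"
  shows "\<exists>F' G'. realizer X \<phi> F' G' \<and> refines X (f(c := Suc v)) F' \<and> refines X g G'"
proof -
  let ?U = "remaining X f"
  have U: "?U \<subseteq> X" by (rule remaining_subset)
  have cU: "extreme \<phi> ?U c" "c \<in> ?U" using c by (auto simp: greedy_choice_def extreme_def)
  have injF: "inj_on F X" and injG: "inj_on G X" using R by (auto simp: realizer_def)
  show ?thesis
  proof (cases "\<forall>x\<in>?U. F x \<le> F c")
    case True
    then have "refines X (f(c := Suc v)) F"
      by (intro refines_peel[OF fF injF f cU(2)]) auto
    then show ?thesis using R gG by blast
  next
    case False
    have Gmax: "\<forall>x\<in>?U. G x \<le> G c"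
      using extreme_is_maximum[OF R U cU(1)] False by blast
    have finU: "finite ?U" using finite_subset[OF U finite_ground] .
    obtain p where p: "p \<in> ?U" "\<And>x. x \<in> ?U \<Longrightarrow> F x \<le> F p"
      using finite_has_maximum[OF finU, of F] cU(2) by blast
    have pc: "p \<noteq> c" using False p by auto
    have "extreme \<phi> ?U p" by (rule maximum_is_extreme[OF R U p])
    then have "g c \<le> g p" using c by (auto simp: greedy_choice_def)
    have Gpc: "G p < G c" using Gmax p pc injG cU U by (metis inj_onD le_neq_implies_less subsetD)
    \<comment> \<open>The point \<open>p\<close> was rejected, so it is not below \<open>c\<close> in \<open>g\<close>; as \<open>c\<close> exceeds it under \<open>G\<close>, it is
      not above \<open>c\<close> either.\<close>
    have "\<not> g c < g p" using gG Gpc p cU U unfolding refines_def by (metis not_less_iff_gr_or_eq subsetD)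
    then have eq: "g p = g c" using \<open>g c \<le> g p\<close> by simp
    have "g c = 0"
    proof (rule ccontr)
      assume "g c \<noteq> 0"
      then have "p \<in> X - remaining X g" "c \<in> X - remaining X g" using p cU eq U by (auto simp: remaining_def)
      then show False using g eq pc unfolding ranked_down_to_def inj_on_def by blast
    qed
    have "?U \<subseteq> remaining X g"
    proof
      fix x assume x: "x \<in> ?U"
      have "\<not> g c < g x" using gG Gmax x cU U unfolding refines_def by (metis leD subsetD)
      then show "x \<in> remaining X g" using \<open>g c = 0\<close> x U by (auto simp: remaining_def)
    qed
    then have same: "remaining X g = ?U"
      using card_subset_eq[of "remaining X g" ?U] card_mono[of "remaining X g" ?U]
        finite_subset[OF remaining_subset finite_ground] f g w
      by (metis antisym ranked_down_to_def)
    have rem: "x \<in> ?U \<longleftrightarrow> f x = 0" "x \<in> ?U \<longleftrightarrow> g x = 0" if "x \<in> X" for x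
      using that same by (auto simp: remaining_def)
    have down: "\<forall>x\<in>?U. \<forall>y\<in>X - ?U. F x < F y \<and> G x < G y"
    proof (intro ballI)
      fix x y assume xy: "x \<in> ?U" "y \<in> X - ?U"
      then have "f x < f y" "g x < g y" using rem[of x] rem[of y] U by auto
      then show "F x < F y \<and> G x < G y" using fF gG xy U unfolding refines_def by blast
    qed
    obtain F' G' where R': "realizer X \<phi> F' G'"
      and in1: "\<forall>x\<in>?U. \<forall>y\<in>?U. F' x < F' y \<longleftrightarrow> G x < G y"
      and out: "\<forall>x\<in>X - ?U. \<forall>y\<in>X - ?U.
        (F' x < F' y \<longleftrightarrow> F x < F y) \<and> (G' x < G' y \<longleftrightarrow> G x < G y)"
      and cross: "\<forall>x\<in>?U. \<forall>y\<in>X - ?U. F' x < F' y \<and> G' x < G' y"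
      using realizer_swap_below[OF finite_ground R U down] by (elim exE conjE)
    have "refines X f F'"
      unfolding refines_def
    proof (intro ballI impI)
      fix x y assume xy: "x \<in> X" "y \<in> X" "f x < f y"
      then have y: "y \<in> X - ?U" using rem[OF xy(2)] by auto
      show "F' x < F' y"
      proof (cases "x \<in> ?U")
        case True
        then show ?thesis using cross y by blast
      next
        case False
        have "F x < F y" using fF xy unfolding refines_def by blast
        then show ?thesis using out y xy(1) False by blast
      qed
    qed
    moreover have "refines X g G'"
      unfolding refines_def
    proof (intro ballI impI)
      fix x y assume xy: "x \<in> X" "y \<in> X" "g x < g y"
      then have y: "y \<in> X - ?U" using rem[OF xy(2)] by auto
      show "G' x < G' y"
      proof (cases "x \<in> ?U")
        case True
        then show ?thesis using cross y by blast
      next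
        case False
        have "G x < G y" using gG xy unfolding refines_def by blast
        then show ?thesis using out y xy(1) False by blast
      qed
    qed
    moreover have "F' x \<le> F' c" if "x \<in> ?U" for x
      using in1 cU(2) Gmax that by (simp add: not_less[symmetric])
    moreover have "inj_on F' X" using R' by (simp add: realizer_def)
    ultimately show ?thesis using refines_peel[OF _ _ f cU(2)] R' by metis
  qed
qed

lemma peeling_keeps_realizer:
  assumes "peeling X \<phi> v f g" "\<exists>F G. realizer X \<phi> F G"
  shows "\<exists>F G. realizer X \<phi> F G \<and> refines X f F \<and> refines X g G"
  using assms(1)
proof (induction rule: peeling.induct)
  case start
  then show ?case using assms(2) by (auto simp: refines_def)
next
  case (round v f g c d)
  have rk: "ranked_down_to X \<phi> (Suc v) f" "ranked_down_to X \<phi> (Suc v) g"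
    using peeling_ranked[OF round.hyps(1)] by auto
  have rk': "ranked_down_to X \<phi> v (f(c := Suc v))"
    using ranked_peel[OF rk(1)] round.hyps(2) by (simp add: greedy_choice_def)
  obtain F G where "realizer X \<phi> F G" "refines X f F" "refines X g G" using round.IH by blast
  from greedy_choice_keeps_realizer[OF this rk order_refl round.hyps(2)]
  obtain F1 G1 where 1: "realizer X \<phi> F1 G1" "refines X (f(c := Suc v)) F1" "refines X g G1"
    by blast
  from greedy_choice_keeps_realizer[OF realizer_sym[OF 1(1)] 1(3,2) rk(2) rk' le_SucI[OF order_refl] round.hyps(3)]
  obtain G2 F2 where 2: "realizer X \<phi> G2 F2" "refines X (g(d := Suc v)) G2"
      "refines X (f(c := Suc v)) F2"
    by blast
  show ?case using realizer_sym[OF 2(1)] 2(2,3) by blast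
qed

text \<open>
  For a complete ranking, refinement in one direction is already equality of the orders.
\<close>

lemma refines_inj_iff:
  assumes "refines X f F" "inj_on f X" "x \<in> X" "y \<in> X"
  shows "f x \<le> f y \<longleftrightarrow> F x \<le> F y"
  using assms unfolding refines_def inj_on_def by (metis le_less less_le_not_le nat_le_linear)

lemma peeling_finds_realizer:
  assumes peel: "peeling X \<phi> 0 f g"
  shows "(\<exists>F G. realizer X \<phi> F G) \<longleftrightarrow> realizer X \<phi> f g"
proof
  assume "\<exists>F G. realizer X \<phi> F G"
  then obtain F G where R: "realizer X \<phi> F G" "refines X f F" "refines X g G"
    using peeling_keeps_realizer[OF peel] by blast
  have inj: "inj_on f X" "inj_on g X" using peeling_ranked[OF peel] ranked_0_inj by auto
  have "x \<in> \<phi> Y \<longleftrightarrow> x \<in> {x\<in>X. (\<exists>a\<in>Y. f x \<le> f a) \<and> (\<exists>b\<in>Y. g x \<le> g b)}"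
    if Y: "Y \<subseteq> X" "Y \<noteq> {}" for Y x
    using realizerD[OF R(1) Y, of x] refines_inj_iff[OF R(2) inj(1), of x]
      refines_inj_iff[OF R(3) inj(2), of x] Y(1)
    unfolding mem_Collect_eq by (metis subsetD)
  then have "\<phi> Y = {x\<in>X. (\<exists>a\<in>Y. f x \<le> f a) \<and> (\<exists>b\<in>Y. g x \<le> g b)}" if "Y \<subseteq> X" "Y \<noteq> {}" for Y
    using that by (intro set_eqI)
  then show "realizer X \<phi> f g" unfolding realizer_def using inj by simp
qed blast

text \<open>
  If one order realizes the geometry, its initial segments are the only closed sets.
  Both rankings then have to induce that order, and complete rankings with the same order are equal.
\<close>

lemma peeling_equal_iff_chain:
  assumes peel: "peeling X \<phi> 0 f g" and R: "realizer X \<phi> f g"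
  shows "(\<exists>h. realizer X \<phi> h h) \<longleftrightarrow> (\<forall>x\<in>X. f x = g x)"
proof
  assume "\<exists>h. realizer X \<phi> h h"
  then obtain h where h: "realizer X \<phi> h h" by blast
  have agree: "f' y \<le> f' x \<longleftrightarrow> h y \<le> h x"
    if f': "ranked_down_to X \<phi> 0 f'" and xy: "x \<in> X" "y \<in> X" for f' x y
  proof -
    have *: "h y \<le> h x \<Longrightarrow> f' y \<le> f' x" if "x \<in> X" "y \<in> X" for x y
      using closure_below_ranking[OF f', of "{x}" y] realizerD[OF h, of "{x}" y] that by simp
    have "inj_on f' X" using ranked_0_inj[OF f'] .
    then show ?thesis using *[of x y] *[of y x] xy by (metis antisym inj_onD nat_le_linear order_refl)
  qed
  have rk: "ranked_down_to X \<phi> 0 f" "ranked_down_to X \<phi> 0 g" using peeling_ranked[OF peel] by auto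
  show "\<forall>x\<in>X. f x = g x"
  proof
    fix x assume x: "x \<in> X"
    have "{y\<in>X. f y \<le> f x} = {y\<in>X. g y \<le> g x}"
      using agree[OF rk(1) x] agree[OF rk(2) x] by blast
    then show "f x = g x" using ranked_0_eq_card[OF rk(1) x] ranked_0_eq_card[OF rk(2) x] by simp
  qed
next
  assume eq: "\<forall>x\<in>X. f x = g x"
  have "x \<in> \<phi> Y \<longleftrightarrow> x \<in> X \<and> (\<exists>a\<in>Y. f x \<le> f a)" if Y: "Y \<subseteq> X" "Y \<noteq> {}" for Y x
    using realizerD[OF R Y, of x] eq Y by (metis subsetD)
  then have "\<phi> Y = {x\<in>X. (\<exists>a\<in>Y. f x \<le> f a) \<and> (\<exists>b\<in>Y. f x \<le> f b)}" if "Y \<subseteq> X" "Y \<noteq> {}" for Y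
    using that by (intro set_eqI) simp
  then have "realizer X \<phi> f f" using R unfolding realizer_def by simp
  then show "\<exists>h. realizer X \<phi> h h" by blast
qed

text \<open>
  The maxima of the two orders together bound all points.
\<close>

lemma closure_of_two_points_is_large:
  assumes R: "realizer X \<phi> f g" and "3 \<le> card X"
  shows "\<exists>Y\<subseteq>X. \<phi> Y \<noteq> Y"
proof -
  have "X \<noteq> {}" using assms(2) by auto
  then obtain p q where pq: "p \<in> X" "\<And>x. x \<in> X \<Longrightarrow> f x \<le> f p" "q \<in> X" "\<And>x. x \<in> X \<Longrightarrow> g x \<le> g q"
    using finite_has_maximum[OF finite_ground, of f] finite_has_maximum[OF finite_ground, of g]
    by metis
  have "\<phi> {p, q} = X"
    using realizerD[OF R, of "{p, q}"] pq by auto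
  moreover have "card {p, q} < card X"
    using assms(2) card_insert_le_m1[of 2 "{q}" p] by (cases "p = q") auto
  ultimately show ?thesis using pq by (intro exI[of _ "{p, q}"]) auto
qed

end


section \<open>Indexing the ground set and closing by repeated passes\<close>

text \<open>
  The closure operator that is transported along an enumeration \<open>e\<close> of the ground set to the indices,
  which are the objects that the machine works with.
\<close>

definition pulled_back :: "'b set \<Rightarrow> ('b \<Rightarrow> 'a) \<Rightarrow> ('a set \<Rightarrow> 'a set) \<Rightarrow> 'b set \<Rightarrow> 'b set" where
  "pulled_back I e \<phi> Y = {i\<in>I. e i \<in> \<phi> (e ` Y)}"

lemma (in closure_operator) image_pulled_back:
  assumes "bij_betw e I X" "Y \<subseteq> I"
  shows "e ` pulled_back I e \<phi> Y = \<phi> (e ` Y)"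
proof -
  have "e ` Y \<subseteq> X" using assms by (auto simp: bij_betw_def)
  then have "\<phi> (e ` Y) \<subseteq> e ` I" using closure_subset assms(1) by (auto simp: bij_betw_def)
  then show ?thesis by (auto simp: pulled_back_def)
qed

lemma (in convex_geometry) convex_geometry_pulled_back:
  assumes e: "bij_betw e I X"
  shows "convex_geometry I (pulled_back I e \<phi>)"
proof unfold_locales
  let ?\<psi> = "pulled_back I e \<phi>"
  have img: "e ` Y \<subseteq> X" if "Y \<subseteq> I" for Y using e that by (auto simp: bij_betw_def)
  have inj: "inj_on e I" using e by (simp add: bij_betw_def)
  show "finite I" using bij_betw_finite[OF e] finite_ground by simp
  show "?\<psi> Y \<subseteq> I" for Y by (auto simp: pulled_back_def)
  show "Y \<subseteq> ?\<psi> Y" if "Y \<subseteq> I" for Y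
    using that extensive[OF img[OF that]] by (auto simp: pulled_back_def)
  show "?\<psi> Y \<subseteq> ?\<psi> Z" if "Z \<subseteq> I" "Y \<subseteq> Z" for Y Z
    using monotone[OF img[OF that(1)] image_mono[OF that(2)]] by (auto simp: pulled_back_def)
  show "?\<psi> (?\<psi> Y) = ?\<psi> Y" if "Y \<subseteq> I" for Y
    using idempotent[OF img[OF that]] image_pulled_back[OF e that]
    by (simp add: pulled_back_def[of I e \<phi> "?\<psi> Y"]) (simp add: pulled_back_def)
  show "?\<psi> {} = {}" using closure_empty by (simp add: pulled_back_def)
  show "x \<notin> ?\<psi> (Y \<union> {z})"
    if Y: "Y \<subseteq> I" "Y = ?\<psi> Y" and xz: "x \<in> I - Y" "z \<in> I - Y" "x \<noteq> z" "z \<in> ?\<psi> (Y \<union> {x})" for Y x z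
  proof -
    have "e ` Y = \<phi> (e ` Y)" using image_pulled_back[OF e Y(1)] Y(2) by simp
    moreover have "e x \<in> X - e ` Y" "e z \<in> X - e ` Y" "e x \<noteq> e z"
      using e xz Y(1) inj by (auto simp: bij_betw_def inj_on_def)
    ultimately have "e x \<notin> \<phi> (e ` Y \<union> {e z})"
      using anti_exchange[OF img[OF Y(1)], of "e x" "e z"] xz(4) by (simp add: pulled_back_def)
    then show ?thesis by (simp add: pulled_back_def)
  qed
qed

lemma realizer_transport:
  assumes R: "realizer X \<phi> f g" and e: "bij_betw e I X"
    and \<psi>: "\<And>Y. Y \<subseteq> I \<Longrightarrow> \<psi> Y \<subseteq> I \<and> e ` \<psi> Y = \<phi> (e ` Y)"
  shows "realizer I \<psi> (f \<circ> e) (g \<circ> e)"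
  unfolding realizer_def
proof (intro conjI allI impI)
  show "inj_on (f \<circ> e) I" "inj_on (g \<circ> e) I"
    using R e by (auto simp: realizer_def bij_betw_def intro!: comp_inj_on)
  fix Y assume Y: "Y \<subseteq> I" "Y \<noteq> {}"
  have inj: "inj_on e I" and eY: "e ` Y \<subseteq> X" using e Y(1) by (auto simp: bij_betw_def)
  have "i \<in> \<psi> Y \<longleftrightarrow> (\<exists>a\<in>Y. (f \<circ> e) i \<le> (f \<circ> e) a) \<and> (\<exists>b\<in>Y. (g \<circ> e) i \<le> (g \<circ> e) b)"
    if i: "i \<in> I" for i
  proof -
    have "i \<in> \<psi> Y \<longleftrightarrow> e i \<in> e ` \<psi> Y"
      using inj_on_image_mem_iff[OF inj i] \<psi>[OF Y(1)] by blast
    then have "i \<in> \<psi> Y \<longleftrightarrow> e i \<in> \<phi> (e ` Y)" using \<psi>[OF Y(1)] by simp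
    also have "\<dots> \<longleftrightarrow> (\<exists>a\<in>Y. f (e i) \<le> f (e a)) \<and> (\<exists>b\<in>Y. g (e i) \<le> g (e b))"
      using realizerD[OF R eY, of "e i"] Y(2) e i by (auto simp: bij_betw_def)
    finally show ?thesis by simp
  qed
  then show "\<psi> Y = {i\<in>I. (\<exists>a\<in>Y. (f \<circ> e) i \<le> (f \<circ> e) a) \<and> (\<exists>b\<in>Y. (g \<circ> e) i \<le> (g \<circ> e) b)}"
    using \<psi>[OF Y(1)] by blast
qed

lemma (in convex_geometry) cdim_eq_2_iff_pulled_back:
  assumes e: "bij_betw e I X"
  defines "\<psi> \<equiv> pulled_back I e \<phi>"
  shows "cdim X \<phi> = 2 \<longleftrightarrow> (\<exists>f g. realizer I \<psi> f g) \<and> \<not> (\<exists>f. realizer I \<psi> f f)"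
proof -
  let ?d = "inv_into I e"
  have d: "bij_betw ?d X I" by (rule bij_betw_inv_into[OF e])
  have to: "\<psi> Y \<subseteq> I \<and> e ` \<psi> Y = \<phi> (e ` Y)" if "Y \<subseteq> I" for Y
    using image_pulled_back[OF e that] by (auto simp: \<psi>_def pulled_back_def)
  have fro: "\<phi> Y \<subseteq> X \<and> ?d ` \<phi> Y = \<psi> (?d ` Y)" if Y: "Y \<subseteq> X" for Y
  proof
    have dY: "?d ` Y \<subseteq> I" using d Y by (auto simp: bij_betw_def)
    have "e ` ?d ` Y = Y" using e Y by (simp add: image_inv_into_cancel bij_betw_def)
    then have "e ` \<psi> (?d ` Y) = \<phi> Y" using to[OF dY] by simp
    then show "?d ` \<phi> Y = \<psi> (?d ` Y)"
      using inv_into_image_cancel[of e I "\<psi> (?d ` Y)"] e to[OF dY] by (auto simp: bij_betw_def)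
  qed (rule closure_subset[OF Y])
  have "realizer I \<psi> (f \<circ> e) (g \<circ> e)" if "realizer X \<phi> f g" for f g
    using realizer_transport[OF that e to] .
  moreover have "realizer X \<phi> (f \<circ> ?d) (g \<circ> ?d)" if "realizer I \<psi> f g" for f g
    using realizer_transport[OF that d fro] .
  ultimately show ?thesis unfolding cdim_eq_2_iff by metis
qed

text \<open>
  One implication applied to a set of indices. A pass is \<open>fold fire L\<close>: each implication sees the
  additions made by the previous ones.
\<close>

fun fire :: "listed_implication \<Rightarrow> nat set \<Rightarrow> nat set" where
  "fire (as, bs) Z = (if set as \<subseteq> Z then Z \<union> set bs else Z)"

definition obeys :: "listed_implication list \<Rightarrow> nat set \<Rightarrow> bool" where
  "obeys L Z \<longleftrightarrow> (\<forall>(as, bs)\<in>set L. set as \<subseteq> Z \<longrightarrow> set bs \<subseteq> Z)"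

lemma fire_increasing: "Z \<subseteq> fire i Z"
  by (cases i) auto

lemma pass_increasing: "Z \<subseteq> fold fire L Z"
proof (induction L arbitrary: Z)
  case (Cons i L)
  then show ?case using fire_increasing[of Z i] by auto
qed simp

lemma pass_stays_below:
  assumes "obeys L W" "Z \<subseteq> W"
  shows "fold fire L Z \<subseteq> W"
  using assms
proof (induction L arbitrary: Z)
  case (Cons i L)
  have "fire i Z \<subseteq> W" using Cons.prems by (cases i) (auto simp: obeys_def)
  then show ?case using Cons by (simp add: obeys_def)
qed simp

lemma fixed_by_pass_obeys:
  assumes "fold fire L Z = Z"
  shows "obeys L Z"
  using assms
proof (induction L)
  case (Cons i L)
  have "fire i Z = Z"
    using Cons.prems fire_increasing[of Z i] pass_increasing[of "fire i Z" L] by auto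
  then show ?case using Cons by (cases i) (auto simp: obeys_def split: if_splits)
qed (simp add: obeys_def)

text \<open>
  A pass that changes the set adds an element, which can happen at most \<open>n\<close> times.
\<close>

lemma iterated_pass_fixed:
  fixes L :: "listed_implication list" and n :: nat
  assumes L: "obeys L {..<n}" and Z: "Z \<subseteq> {..<n}"
  defines "F \<equiv> fold fire L"
  shows "F ((F ^^ n) Z) = (F ^^ n) Z"
proof -
  have below: "(F ^^ i) Z \<subseteq> {..<n}" for i
    by (induction i) (auto simp: F_def Z dest: subsetD[OF pass_stays_below[OF L]])
  have "F ((F ^^ i) Z) = (F ^^ i) Z \<or> i \<le> card ((F ^^ i) Z)" for i
  proof (induction i)
    case (Suc i)
    show ?case
    proof (cases "F ((F ^^ i) Z) = (F ^^ i) Z")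
      case False
      then have "(F ^^ i) Z \<subset> (F ^^ Suc i) Z" using pass_increasing by (auto simp: F_def)
      then have "card ((F ^^ i) Z) < card ((F ^^ Suc i) Z)"
        using below[of "Suc i"] by (intro psubset_card_mono finite_subset[OF below]) auto
      then show ?thesis using Suc False by simp
    qed simp
  qed simp
  from this[of n] show ?thesis
  proof
    assume "n \<le> card ((F ^^ n) Z)"
    then have "(F ^^ n) Z = {..<n}" using below[of n] by (intro card_seteq) auto
    moreover have "F {..<n} = {..<n}"
      using pass_stays_below[OF L subset_refl] pass_increasing unfolding F_def by (rule subset_antisym)
    ultimately show ?thesis by (simp only:)
  qed
qed

text \<open>
  If \<open>Z\<close> satisfies the basis, then it satisfies the implication from \<open>Z\<close> to \<open>\<phi> Z\<close>.
\<close>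

lemma (in closure_operator) closed_iff_satisfies_basis:
  assumes "implicational_basis X \<phi> S" "Z \<subseteq> X"
  shows "\<phi> Z = Z \<longleftrightarrow> (\<forall>i\<in>S. satisfies Z i)"
proof
  assume Z: "\<phi> Z = Z"
  have "satisfies Z (A, B)" if "(A, B) \<in> S" for A B
  proof -
    have "holds_in X \<phi> (A, B)" using assms(1) that unfolding implicational_basis_def by blast
    then have "B \<subseteq> \<phi> A" by (simp add: holds_in_def)
    then show ?thesis using monotone[OF assms(2), of A] Z by (auto simp: satisfies_def)
  qed
  then show "\<forall>i\<in>S. satisfies Z i" by auto
next
  assume "\<forall>i\<in>S. satisfies Z i"
  moreover have "holds_in X \<phi> (Z, \<phi> Z)"
    using assms(2) closure_subset by (simp add: holds_in_def)
  ultimately have "satisfies Z (Z, \<phi> Z)"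
    using assms unfolding implicational_basis_def logical_consequence_def by blast
  then show "\<phi> Z = Z" using extensive[OF assms(2)] by (auto simp: satisfies_def)
qed

text \<open>
  The passes never leave a closed set above \<open>Y\<close>, and their fixed point satisfies the basis.
\<close>

lemma (in convex_geometry) iterated_pass_eq_closure:
  assumes S: "implicational_basis X \<phi> S" and L: "lists_basis X S e L"
    and Y: "Y \<subseteq> {..<card X}"
  shows "(fold fire L ^^ card X) Y = pulled_back {..<card X} e \<phi> Y"
proof -
  let ?n = "card X" and ?\<psi> = "pulled_back {..<card X} e \<phi>"
  have e: "bij_betw e {..<?n} X" using L by (simp add: lists_basis_def)
  then have inj: "inj_on e {..<?n}" by (simp add: bij_betw_def)
  interpret pb: convex_geometry "{..<?n}" ?\<psi> by (rule convex_geometry_pulled_back[OF e])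
  have listed: "set as \<subseteq> {..<?n} \<and> set bs \<subseteq> {..<?n}" if "(as, bs) \<in> set L" for as bs
    using L that by (auto simp: lists_basis_def)
  have closed: "?\<psi> Z = Z \<longleftrightarrow> obeys L Z" if Z: "Z \<subseteq> {..<?n}" for Z
  proof -
    have "?\<psi> Z \<subseteq> {..<?n}" by (auto simp: pulled_back_def)
    then have "?\<psi> Z = Z \<longleftrightarrow> e ` ?\<psi> Z = e ` Z" using inj_on_image_eq_iff[OF inj _ Z] by blast
    also have "\<dots> \<longleftrightarrow> \<phi> (e ` Z) = e ` Z" using image_pulled_back[OF e Z] by simp
    also have "\<dots> \<longleftrightarrow> (\<forall>i\<in>S. satisfies (e ` Z) i)"
      by (rule closed_iff_satisfies_basis[OF S]) (use e Z in \<open>auto simp: bij_betw_def\<close>)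
    also have "\<dots> \<longleftrightarrow> obeys L Z"
    proof -
      have "e ` A \<subseteq> e ` Z \<longleftrightarrow> A \<subseteq> Z" if "A \<subseteq> {..<?n}" for A
        using inj_on_image_mem_iff[OF inj _ Z] that by blast
      then have "satisfies (e ` Z) (denoted e (as, bs)) \<longleftrightarrow> (set as \<subseteq> Z \<longrightarrow> set bs \<subseteq> Z)"
        if "(as, bs) \<in> set L" for as bs
        using listed[OF that] by (simp add: satisfies_def denoted_def)
      moreover have "S = denoted e ` set L" using L by (simp add: lists_basis_def)
      ultimately show ?thesis by (fastforce simp: obeys_def)
    qed
    finally show ?thesis .
  qed
  have top: "obeys L {..<?n}" using listed by (auto simp: obeys_def)
  let ?Z = "(fold fire L ^^ ?n) Y"
  have up: "Y \<subseteq> (fold fire L ^^ i) Y" for i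
  proof (induction i)
    case (Suc i)
    then show ?case using pass_increasing[of "(fold fire L ^^ i) Y" L] by simp
  qed simp
  have down: "(fold fire L ^^ i) Y \<subseteq> ?\<psi> Y" for i
  proof (induction i)
    case 0
    then show ?case using pb.extensive[OF Y] by simp
  next
    case (Suc i)
    have "obeys L (?\<psi> Y)" using closed[of "?\<psi> Y"] pb.idempotent[OF Y] pb.closure_subset[OF Y] by simp
    then show ?case using pass_stays_below[OF _ Suc] by simp
  qed
  have Zn: "?Z \<subseteq> {..<?n}" using down[of ?n] pb.closure_subset[OF Y] by blast
  have "?\<psi> ?Z = ?Z"
    using fixed_by_pass_obeys[OF iterated_pass_fixed[OF top Y]] closed[OF Zn] by simp
  then have "?\<psi> Y \<subseteq> ?Z" using pb.monotone[OF Zn up[of ?n]] by simp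
  then show ?thesis using down[of ?n] by blast
qed

lemma basis_size_listed:
  assumes "lists_basis X S e L"
  shows "basis_size S = (\<Sum>(as, bs)\<leftarrow>L. length as + length bs)" "card S = length L"
proof -
  have dist: "distinct (map (denoted e) L)" and S: "S = set (map (denoted e) L)"
    using assms by (auto simp: lists_basis_def)
  show "card S = length L" using distinct_card[OF dist] S by simp
  have inj: "inj_on e {..<card X}" using assms by (simp add: lists_basis_def bij_betw_def)
  have "basis_size S = (\<Sum>(A, B)\<leftarrow>map (denoted e) L. card A + card B)"
    unfolding basis_size_def S by (rule sum_list_distinct_conv_sum_set[OF dist, symmetric])
  also have "\<dots> = (\<Sum>(as, bs)\<leftarrow>L. length as + length bs)"
  proof -
    have "card (e ` set xs) = length xs" if "distinct xs" "set xs \<subseteq> {..<card X}" for xs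
      using that inj by (metis card_image distinct_card inj_on_subset)
    then show ?thesis using assms
      by (auto simp: lists_basis_def denoted_def o_def split_def intro!: arg_cong[where f = sum_list])
  qed
  finally show "basis_size S = (\<Sum>(as, bs)\<leftarrow>L. length as + length bs)" .
qed


section \<open>Time-counting weakest preconditions\<close>

text \<open>
  Total correctness with time: \<open>P\<close> halts, and \<open>Q\<close> holds of the number of steps and the final
  state. As execution is deterministic, \<open>wp\<close> of straight-line code can be evaluated by rewriting.
\<close>

definition wp :: "program \<Rightarrow> (nat \<Rightarrow> state \<Rightarrow> bool) \<Rightarrow> state \<Rightarrow> bool" where
  "wp P Q s \<longleftrightarrow> (\<exists>t s'. exec P s t s' \<and> Q t s')"

text \<open>
  Each list ends in a \<open>Skip\<close>, which costs one step and is included in all bounds below.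
\<close>

fun seqs :: "program list \<Rightarrow> program" where
  "seqs [] = Skip"
| "seqs (P # Ps) = Seq P (seqs Ps)"

lemma wp_of_exec: "exec P s t s' \<Longrightarrow> wp P Q s \<longleftrightarrow> Q t s'"
  unfolding wp_def using exec_deterministic by blast

lemma wp_Skip: "wp Skip Q s \<longleftrightarrow> Q 1 s"
  by (rule wp_of_exec[OF exec.Skip])

lemma wp_Const: "wp (Const i c) Q (r, M) \<longleftrightarrow> Q 1 (r(i := c), M)"
  by (rule wp_of_exec[OF exec.Const])

lemma wp_Add: "wp (Add i j l) Q (r, M) \<longleftrightarrow> Q 1 (r(i := r j + r l), M)"
  by (rule wp_of_exec[OF exec.Add])

lemma wp_Sub: "wp (Sub i j l) Q (r, M) \<longleftrightarrow> Q 1 (r(i := r j - r l), M)"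
  by (rule wp_of_exec[OF exec.Sub])

lemma wp_Load: "wp (Load i j) Q (r, M) \<longleftrightarrow> Q 1 (r(i := M (r j)), M)"
  by (rule wp_of_exec[OF exec.Load])

lemma wp_Store: "wp (Store i j) Q (r, M) \<longleftrightarrow> Q 1 (r, M(r i := r j))"
  by (rule wp_of_exec[OF exec.Store])

lemma wp_Seq: "wp (Seq P P') Q s \<longleftrightarrow> wp P (\<lambda>t. wp P' (\<lambda>u. Q (t + u))) s"
proof
  assume "wp (Seq P P') Q s"
  then obtain t s' where "exec (Seq P P') s t s'" "Q t s'" unfolding wp_def by blast
  then show "wp P (\<lambda>t. wp P' (\<lambda>u. Q (t + u))) s"
    by (elim exec_SeqE) (auto simp only: wp_def)
next
  assume "wp P (\<lambda>t. wp P' (\<lambda>u. Q (t + u))) s"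
  then obtain t s1 u s2 where "exec P s t s1" "exec P' s1 u s2" "Q (t + u) s2"
    unfolding wp_def by blast
  then show "wp (Seq P P') Q s" unfolding wp_def using exec.Seq by blast
qed

lemma wp_IfNonzero:
  "wp (IfNonzero i P P') Q (r, M) \<longleftrightarrow>
     (if r i = 0 then wp P' (\<lambda>t. Q (Suc t)) (r, M) else wp P (\<lambda>t. Q (Suc t)) (r, M))"
    (is "_ \<longleftrightarrow> ?rhs")
proof (cases "r i = 0")
  case True
  show ?thesis
  proof
    assume "wp (IfNonzero i P P') Q (r, M)"
    then obtain t s' where "exec (IfNonzero i P P') (r, M) t s'" "Q t s'" unfolding wp_def by blast
    then have "wp P' (\<lambda>t. Q (Suc t)) (r, M)"
      using True by (elim exec_IfE) (auto simp only: wp_def fst_conv)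
    then show ?rhs using True by simp
  next
    assume ?rhs
    then obtain t s' where "exec P' (r, M) t s'" "Q (Suc t) s'" using True by (auto simp: wp_def)
    then show "wp (IfNonzero i P P') Q (r, M)"
      unfolding wp_def using exec.IfFalse True by (metis fst_conv)
  qed
next
  case False
  show ?thesis
  proof
    assume "wp (IfNonzero i P P') Q (r, M)"
    then obtain t s' where "exec (IfNonzero i P P') (r, M) t s'" "Q t s'" unfolding wp_def by blast
    then have "wp P (\<lambda>t. Q (Suc t)) (r, M)"
      using False by (elim exec_IfE) (auto simp only: wp_def fst_conv)
    then show ?rhs using False by simp
  next
    assume ?rhs
    then obtain t s' where "exec P (r, M) t s'" "Q (Suc t) s'" using False by (auto simp: wp_def)
    then show "wp (IfNonzero i P P') Q (r, M)"
      unfolding wp_def using exec.IfTrue False by (metis fst_conv)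
  qed
qed

lemma wp_WhileNonzero:
  "wp (WhileNonzero i P) Q (r, M) \<longleftrightarrow>
     (if r i = 0 then Q 1 (r, M)
      else wp P (\<lambda>t. wp (WhileNonzero i P) (\<lambda>u. Q (Suc (t + u)))) (r, M))"
    (is "_ \<longleftrightarrow> ?rhs")
proof (cases "r i = 0")
  case True
  then show ?thesis using wp_of_exec[OF exec.WhileFalse[of "(r, M)" i P]] by simp
next
  case False
  show ?thesis
  proof
    assume "wp (WhileNonzero i P) Q (r, M)"
    then obtain t s' where "exec (WhileNonzero i P) (r, M) t s'" "Q t s'" unfolding wp_def by blast
    then show ?rhs using False by - (erule exec_WhileE, simp, auto simp only: wp_def fst_conv if_False)
  next
    assume ?rhs
    then have "wp P (\<lambda>t. wp (WhileNonzero i P) (\<lambda>u. Q (Suc (t + u)))) (r, M)"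
      using False by simp
    then obtain t s1 u s2 where "exec P (r, M) t s1" "exec (WhileNonzero i P) s1 u s2"
        "Q (Suc (t + u)) s2"
      unfolding wp_def by blast
    then show "wp (WhileNonzero i P) Q (r, M)"
      unfolding wp_def using exec.WhileTrue[of "(r, M)" i P t s1 u s2] False by (metis fst_conv)
  qed
qed

lemmas wp_simps = wp_Skip wp_Const wp_Add wp_Sub wp_Load wp_Store wp_Seq wp_IfNonzero

lemma wp_mono:
  assumes "wp P Q s" "\<And>t r M. Q t (r, M) \<Longrightarrow> Q' t (r, M)"
  shows "wp P Q' s"
  using assms unfolding wp_def by (metis surj_pair)

text \<open>
  The loop invariant is indexed by the items still to be processed. This lets the cost \<open>T\<close> of an
  iteration depend on the item, as it does when register \<open>i\<close> counts the implications left in a list.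
\<close>

lemma wp_foreach:
  assumes "I xs s"
    and body: "\<And>x xs r M. I (x # xs) (r, M) \<Longrightarrow>
      r i \<noteq> 0 \<and> wp P (\<lambda>t s'. t \<le> T x \<and> I xs s') (r, M)"
    and stop: "\<And>r M. I [] (r, M) \<Longrightarrow> r i = 0"
  shows "wp (WhileNonzero i P) (\<lambda>t s'. t \<le> (\<Sum>x\<leftarrow>xs. T x + 1) + 1 \<and> I [] s') s"
  using assms(1)
proof (induction xs arbitrary: s)
  case Nil
  obtain r M where s: "s = (r, M)" by force
  show ?case using stop[of r M] Nil unfolding s by (subst wp_WhileNonzero) simp
next
  case (Cons x xs)
  obtain r M where s: "s = (r, M)" by force
  let ?Q = "\<lambda>xs t s'. t \<le> (\<Sum>x\<leftarrow>xs. T x + 1) + 1 \<and> I [] s'"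
  have x: "r i \<noteq> 0 \<and> wp P (\<lambda>t s'. t \<le> T x \<and> I xs s') s" using body Cons.prems s by blast
  then have "wp P (\<lambda>t. wp (WhileNonzero i P) (\<lambda>u. ?Q (x # xs) (Suc (t + u)))) s"
  proof (elim conjE, rule_tac wp_mono)
    fix t r' M' assume 1: "t \<le> T x \<and> I xs (r', M')"
    then have "wp (WhileNonzero i P) (?Q xs) (r', M')" using Cons.IH by blast
    then show "wp (WhileNonzero i P) (\<lambda>u. ?Q (x # xs) (Suc (t + u))) (r', M')"
      by (rule wp_mono) (use 1 in auto)
  qed
  then show ?case using x unfolding s by (subst wp_WhileNonzero) simp
qed

lemma wp_countdown:
  assumes "I N s"
    and "\<And>k r M. I k (r, M) \<Longrightarrow> r i = k"
    and "\<And>k r M. k < N \<Longrightarrow> I (Suc k) (r, M) \<Longrightarrow> wp P (\<lambda>t s'. t \<le> T \<and> I k s') (r, M)"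
  shows "wp (WhileNonzero i P) (\<lambda>t s'. t \<le> N * (T + 1) + 1 \<and> I 0 s') s"
proof -
  let ?I = "\<lambda>xs :: unit list. \<lambda>s. length xs \<le> N \<and> I (length xs) s"
  have "wp (WhileNonzero i P)
      (\<lambda>t s'. t \<le> (\<Sum>x\<leftarrow>replicate N (). T + 1) + 1 \<and> ?I [] s') s"
  proof (rule wp_foreach)
    show "?I (replicate N ()) s" using assms(1) by simp
    fix x xs r M assume inv: "?I (x # xs) (r, M)"
    then have "wp P (\<lambda>t s'. t \<le> T \<and> I (length xs) s') (r, M)" using assms(3) by simp
    then have "wp P (\<lambda>t s'. t \<le> T \<and> ?I xs s') (r, M)"
      by (rule wp_mono) (use inv in auto)
    moreover have "r i = Suc (length xs)" using assms(2)[of "Suc (length xs)" r M] inv by simp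
    ultimately show "r i \<noteq> 0 \<and> wp P (\<lambda>t s'. t \<le> T \<and> ?I xs s') (r, M)" by simp
  next
    fix r M assume "?I [] (r, M)"
    then show "r i = 0" using assms(2)[of 0 r M] by simp
  qed
  then show ?thesis by (rule wp_mono) (auto simp: sum_list_replicate)
qed


section \<open>Computing closures on the machine\<close>

text \<open>
  The registers have the following roles. Registers 40 to 46 hold \<open>1\<close>, \<open>n\<close>, \<open>m\<close>, the first address
  behind the input, \<open>0\<close>, and the base addresses of the two rankings. The \<open>n\<close> cells from the address
  in register 43 on contain the set whose closure is being computed, one cell for each point; the
  cells with non-zero content are the marked ones. Registers 2 to 9 are used by the closure
  program, with the read position in register 6 and the outcome of the test of a premise in
  register 4. Registers 10 to 17 serve the choice of an extreme point, where registers 15 to 17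
  are scratch space that the verification also uses. Register 30 contains the rank that is being
  given out, registers 20 to 23 the pair of points under verification with their ranks, and
  registers 31 and 32 the results of the verification.
\<close>

definition stored :: "(nat \<Rightarrow> nat) \<Rightarrow> nat \<Rightarrow> nat list \<Rightarrow> bool" where
  "stored M p xs \<longleftrightarrow> (\<forall>i<length xs. M (p + i) = xs ! i)"

lemma stored_Nil [simp]: "stored M p []"
  by (simp add: stored_def)

lemma stored_Cons [simp]: "stored M p (x # xs) \<longleftrightarrow> M p = x \<and> stored M (Suc p) xs"
  unfolding stored_def by (auto simp: All_less_Suc2)

lemma stored_append [simp]:
  "stored M p (xs @ ys) \<longleftrightarrow> stored M p xs \<and> stored M (p + length xs) ys"
  by (induction xs arbitrary: p) auto

lemma stored_cong:
  "\<lbrakk>stored M p xs; \<And>a. p \<le> a \<Longrightarrow> a < p + length xs \<Longrightarrow> M' a = M a\<rbrakk> \<Longrightarrow> stored M' p xs"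
  by (auto simp: stored_def)

definition test_premise :: program where
  "test_premise = WhileNonzero 3 (seqs
    [Load 5 6, Add 5 5 43, Load 5 5, IfNonzero 5 Skip (Const 4 0), Add 6 6 40, Sub 3 3 40])"

definition add_conclusion :: program where
  "add_conclusion = WhileNonzero 3 (seqs
    [IfNonzero 4 (seqs [Load 5 6, Add 5 5 43, Store 5 40]) Skip, Add 6 6 40, Sub 3 3 40])"

definition fire_program :: program where
  "fire_program = seqs [Load 3 6, Add 6 6 40, Const 4 1, test_premise,
    Load 3 6, Add 6 6 40, add_conclusion]"

definition pass_program :: program where
  "pass_program = seqs [Add 6 40 40, Add 2 42 44, WhileNonzero 2 (seqs [fire_program, Sub 2 2 40])]"

definition closure_program :: program where
  "closure_program = seqs [Add 9 41 44, WhileNonzero 9 (seqs [pass_program, Sub 9 9 40])]"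

text \<open>
  Marks the points that have no rank in the array whose base address is in register \<open>own\<close>.
\<close>

definition unranked_program :: "nat \<Rightarrow> program" where
  "unranked_program own = seqs [Add 15 41 44, WhileNonzero 15 (seqs
    [Sub 15 15 40, Add 16 own 15, Load 16 16, Add 17 43 15,
     IfNonzero 16 (Store 17 44) (Store 17 40)])]"

text \<open>
  One candidate \<open>x\<close>, in register 12: if \<open>x\<close> is unranked and not in the closure of the other unranked
  points, it competes by its rank in the other array. Registers 10 and 11 hold the best rank and its
  point.
\<close>

definition select_body :: "nat \<Rightarrow> nat \<Rightarrow> program" where
  "select_body own other = seqs
    [Sub 12 12 40, Add 13 own 12, Load 14 13,
     IfNonzero 14 Skip (seqs
       [unranked_program own, Add 17 43 12, Store 17 44, closure_program, Add 17 43 12, Load 17 17,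
        IfNonzero 17 Skip (seqs
          [Add 16 other 12, Load 16 16, Sub 17 10 16,
           IfNonzero 17 (seqs [Add 10 16 44, Add 11 12 44]) Skip])])]"

text \<open>
  The best rank starts at \<open>n + 1\<close>, above every rank, so the first extreme point is accepted.
\<close>

definition peel_program :: "nat \<Rightarrow> nat \<Rightarrow> program" where
  "peel_program own other = seqs
    [Add 10 41 40, Const 11 0, Add 12 41 44, WhileNonzero 12 (select_body own other),
     Add 13 own 11, Store 13 30]"

definition peeling_program :: program where
  "peeling_program = seqs [Add 30 41 44, WhileNonzero 30 (seqs
    [peel_program 45 46, peel_program 46 45, Sub 30 30 40])]"

locale listing =
  fixes n :: nat and L :: "listed_implication list"
  assumes listed: "(as, bs) \<in> set L \<Longrightarrow> set as \<subseteq> {..<n} \<and> set bs \<subseteq> {..<n}"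
begin

definition input_end :: nat where "input_end = length (encode n L)"

definition weight :: nat where "weight = (\<Sum>(as, bs)\<leftarrow>L. length as + length bs) + length L"

text \<open>
  All bounds are stated as multiples of this number, which bounds the time for one closure up to a
  constant factor.
\<close>

definition unit_cost :: nat where "unit_cost = (weight + 1) * (n + 1)"

definition layout :: "(nat \<Rightarrow> nat) \<Rightarrow> bool" where
  "layout r \<longleftrightarrow> r 40 = 1 \<and> r 41 = n \<and> r 42 = length L \<and> r 43 = input_end \<and> r 44 = 0 \<and>
     r 45 = input_end + n \<and> r 46 = input_end + 2 * n"

definition marked :: "(nat \<Rightarrow> nat) \<Rightarrow> nat set" where
  "marked M = {x. x < n \<and> M (input_end + x) \<noteq> 0}"

definition same_outside_marks :: "(nat \<Rightarrow> nat) \<Rightarrow> (nat \<Rightarrow> nat) \<Rightarrow> bool" where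
  "same_outside_marks M M' \<longleftrightarrow> (\<forall>a. \<not> (input_end \<le> a \<and> a < input_end + n) \<longrightarrow> M' a = M a)"

lemma marked_subset: "marked M \<subseteq> {..<n}"
  by (auto simp: marked_def)

lemma marked_insert: "x < n \<Longrightarrow> v \<noteq> 0 \<Longrightarrow> marked (M(input_end + x := v)) = insert x (marked M)"
  by (auto simp: marked_def)

lemma marked_remove: "marked (M(input_end + x := 0)) = marked M - {x}"
  by (auto simp: marked_def)

lemma same_outside_marks_refl: "same_outside_marks M M"
  by (simp add: same_outside_marks_def)

lemma same_outside_marks_trans:
  "same_outside_marks M M' \<Longrightarrow> same_outside_marks M' M'' \<Longrightarrow> same_outside_marks M M''"
  by (simp add: same_outside_marks_def)

lemma same_outside_marks_update: "x < n \<Longrightarrow> same_outside_marks M (M(input_end + x := v))"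
  by (simp add: same_outside_marks_def)

lemma stored_same_outside_marks:
  "same_outside_marks M M' \<Longrightarrow> stored M p xs \<Longrightarrow> p + length xs \<le> input_end \<Longrightarrow> stored M' p xs"
  by (erule stored_cong) (simp add: same_outside_marks_def)

lemma layout_cong: "layout r \<Longrightarrow> \<forall>j\<ge>40. r' j = r j \<Longrightarrow> layout r'"
  by (simp add: layout_def)

lemma wp_test_premise:
  assumes c: "layout r" and as: "stored M (r 6) as" "r 3 = length as" "set as \<subseteq> {..<n}"
    and post: "\<And>t r'. \<lbrakk>t \<le> 10 * length as + 1; r' 6 = r 6 + length as;
      r' 4 \<noteq> 0 \<longleftrightarrow> r 4 \<noteq> 0 \<and> set as \<subseteq> marked M;
      \<forall>j. j \<notin> {3, 4, 5, 6} \<longrightarrow> r' j = r j\<rbrakk> \<Longrightarrow> Q t (r', M)"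
  shows "wp test_premise Q (r, M)"
proof -
  define I :: "nat list \<Rightarrow> state \<Rightarrow> bool" where
    "I rest = (\<lambda>(r', M'). M' = M \<and> stored M (r' 6) rest \<and> r' 3 = length rest \<and>
      r' 6 + length rest = r 6 + length as \<and> set rest \<subseteq> {..<n} \<and>
      (r' 4 \<noteq> 0 \<and> set rest \<subseteq> marked M \<longleftrightarrow> r 4 \<noteq> 0 \<and> set as \<subseteq> marked M) \<and>
      (\<forall>j. j \<notin> {3, 4, 5, 6} \<longrightarrow> r' j = r j))" for rest
  have "wp test_premise (\<lambda>t s'. t \<le> (\<Sum>x\<leftarrow>as. 9 + 1) + 1 \<and> I [] s') (r, M)"
    unfolding test_premise_def
  proof (rule wp_foreach)
    show "I as (r, M)" using as by (simp add: I_def)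
    fix a rest r' M' assume inv: "I (a # rest) (r', M')"
    have "r' 40 = 1" "r' 43 = input_end" using inv c by (simp_all add: I_def layout_def)
    moreover have "a \<in> marked M \<longleftrightarrow> M (input_end + a) \<noteq> 0" using inv by (simp add: I_def marked_def)
    ultimately show "r' 3 \<noteq> 0 \<and> wp (seqs [Load 5 6, Add 5 5 43, Load 5 5,
        IfNonzero 5 Skip (Const 4 0), Add 6 6 40, Sub 3 3 40])
        (\<lambda>t s'. t \<le> 9 \<and> I rest s') (r', M')"
      using inv by (auto simp: I_def wp_simps add.commute)
  qed (simp add: I_def)
  then show ?thesis by (rule wp_mono) (auto simp: I_def sum_list_triv intro!: post)
qed

lemma wp_add_conclusion:
  assumes c: "layout r" and bs: "stored M (r 6) bs" "r 3 = length bs" "set bs \<subseteq> {..<n}"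
      "r 6 + length bs \<le> input_end"
    and post: "\<And>t r' M'. \<lbrakk>t \<le> 10 * length bs + 1; same_outside_marks M M';
      r' 6 = r 6 + length bs; marked M' = (if r 4 = 0 then marked M else marked M \<union> set bs);
      \<forall>j. j \<notin> {3, 4, 5, 6} \<longrightarrow> r' j = r j\<rbrakk> \<Longrightarrow> Q t (r', M')"
  shows "wp add_conclusion Q (r, M)"
proof -
  define I :: "nat list \<Rightarrow> state \<Rightarrow> bool" where
    "I rest = (\<lambda>(r', M'). same_outside_marks M M' \<and> stored M (r' 6) rest \<and> r' 3 = length rest \<and>
      r' 6 + length rest = r 6 + length bs \<and> set rest \<subseteq> {..<n} \<and>
      (if r 4 = 0 then marked M' = marked M else marked M' \<union> set rest = marked M \<union> set bs) \<and>
      (\<forall>j. j \<notin> {3, 5, 6} \<longrightarrow> r' j = r j))" for rest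
  have "wp add_conclusion (\<lambda>t s'. t \<le> (\<Sum>x\<leftarrow>bs. 9 + 1) + 1 \<and> I [] s') (r, M)"
    unfolding add_conclusion_def
  proof (rule wp_foreach)
    show "I bs (r, M)" using bs by (simp add: I_def same_outside_marks_refl)
    fix b rest r' M' assume inv: "I (b # rest) (r', M')"
    have regs: "r' 40 = 1" "r' 43 = input_end" "r' 4 = r 4"
      using inv c by (simp_all add: I_def layout_def)
    have "M' (r' 6) = M (r' 6)" and b: "M (r' 6) = b" "b < n"
      using inv bs(4) by (simp_all add: I_def same_outside_marks_def)
    moreover have "same_outside_marks M (M'(input_end + b := Suc 0))"
      using inv same_outside_marks_trans[OF _ same_outside_marks_update[OF b(2)]] by (auto simp: I_def)
    ultimately show "r' 3 \<noteq> 0 \<and> wp (seqs [IfNonzero 4 (seqs [Load 5 6, Add 5 5 43, Store 5 40]) Skip,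
        Add 6 6 40, Sub 3 3 40]) (\<lambda>t s'. t \<le> 9 \<and> I rest s') (r', M')"
      using inv regs marked_insert[OF b(2), of 1 M']
      by (auto simp: I_def wp_simps add.commute[of b])
  qed (simp add: I_def)
  then show ?thesis
    by (rule wp_mono) (auto simp: I_def sum_list_triv intro!: post split: if_splits)
qed

lemma wp_fire_program:
  assumes c: "layout r" and stored: "stored M (r 6) (encode_implication (as, bs))"
    and bound: "r 6 + length (encode_implication (as, bs)) \<le> input_end" and mem: "(as, bs) \<in> set L"
    and post: "\<And>t r' M'. \<lbrakk>t \<le> 10 * (length as + length bs) + 10; same_outside_marks M M';
      r' 6 = r 6 + length (encode_implication (as, bs)); marked M' = fire (as, bs) (marked M);
      \<forall>j. j \<notin> {3, 4, 5, 6} \<longrightarrow> r' j = r j\<rbrakk> \<Longrightarrow> Q t (r', M')"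
  shows "wp fire_program Q (r, M)"
proof -
  have sub: "set as \<subseteq> {..<n}" "set bs \<subseteq> {..<n}" using listed[OF mem] by auto
  have one: "r 40 = 1" using c by (simp add: layout_def)
  have st: "M (r 6) = length as" "stored M (Suc (r 6)) as" "M (Suc (r 6 + length as)) = length bs"
      "stored M (Suc (Suc (r 6 + length as))) bs"
    using stored by (simp_all add: encode_implication_def)
  have len: "length (encode_implication (as, bs)) = length as + length bs + 2"
    by (simp add: encode_implication_def)
  show ?thesis
    unfolding fire_program_def
    apply (simp add: wp_simps one st)
    apply (rule wp_test_premise[where as = as])
    subgoal using c by (rule layout_cong) simp
    subgoal by (simp add: st)
    subgoal by simp
    subgoal by (rule sub)
    subgoal for t r'
      apply (simp add: wp_simps one st)
      apply (rule wp_add_conclusion[where bs = bs])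
      subgoal using c by (rule layout_cong) simp
      subgoal by (simp add: st)
      subgoal by simp
      subgoal by (rule sub)
      subgoal using bound by (simp add: len)
      subgoal by (simp only: wp_Skip, rule post) (auto simp: len)
      done
    done
qed

definition implication_cost :: "listed_implication \<Rightarrow> nat" where
  "implication_cost = (\<lambda>(as, bs). length as + length bs)"

text \<open>
  While the list is scanned, the marked set at each moment is such that applying the rest of the
  list to it gives the result of the whole pass.
\<close>

lemma wp_pass_program:
  assumes c: "layout r" and stored: "stored M 0 (encode n L)"
    and post: "\<And>t r' M'. \<lbrakk>t \<le> 13 * weight + 5; same_outside_marks M M'; marked M' = fold fire L (marked M);
      \<forall>j. j \<notin> {2, 3, 4, 5, 6} \<longrightarrow> r' j = r j\<rbrakk> \<Longrightarrow> Q t (r', M')"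
  shows "wp pass_program Q (r, M)"
proof -
  define I :: "listed_implication list \<Rightarrow> state \<Rightarrow> bool" where
    "I rest = (\<lambda>(r', M'). same_outside_marks M M' \<and>
      stored M (r' 6) (concat (map encode_implication rest)) \<and> r' 2 = length rest \<and>
      r' 6 + length (concat (map encode_implication rest)) = input_end \<and> set rest \<subseteq> set L \<and>
      fold fire rest (marked M') = fold fire L (marked M) \<and>
      (\<forall>j. j \<notin> {2, 3, 4, 5, 6} \<longrightarrow> r' j = r j))" for rest
  have regs: "r 40 = 1" "r 42 = length L" "r 44 = 0" using c by (simp_all add: layout_def)
  let ?r = "r(6 := 2, 2 := length L)"
  have loop: "wp (WhileNonzero 2 (seqs [fire_program, Sub 2 2 40]))
      (\<lambda>t s'. t \<le> (\<Sum>i\<leftarrow>L. (10 * implication_cost i + 12) + 1) + 1 \<and> I [] s') (?r, M)"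
  proof (rule wp_foreach)
    have "stored M 2 (concat (map encode_implication L))"
      using stored by (simp add: encode_def numeral_2_eq_2)
    then show "I L (?r, M)" by (simp add: I_def same_outside_marks_refl input_end_def encode_def)
    fix i rest r' M' assume inv: "I (i # rest) (r', M')"
    obtain as bs where i: "i = (as, bs)" by force
    have c': "layout r'" using c by (rule layout_cong) (use inv in \<open>simp add: I_def\<close>)
    then have one: "r' 40 = 1" by (simp add: layout_def)
    show "r' 2 \<noteq> 0 \<and> wp (seqs [fire_program, Sub 2 2 40])
        (\<lambda>t s'. t \<le> 10 * implication_cost i + 12 \<and> I rest s') (r', M')"
    proof
      show "r' 2 \<noteq> 0" using inv by (simp add: I_def)
      show "wp (seqs [fire_program, Sub 2 2 40])
        (\<lambda>t s'. t \<le> 10 * implication_cost i + 12 \<and> I rest s') (r', M')"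
        unfolding seqs.simps wp_Seq
      proof (rule wp_fire_program[OF c'])
        have "stored M (r' 6) (encode_implication (as, bs))"
          using inv i by (simp add: I_def)
        then show "stored M' (r' 6) (encode_implication (as, bs))"
          by (rule stored_same_outside_marks[rotated]) (use inv i in \<open>auto simp: I_def\<close>)
        show "r' 6 + length (encode_implication (as, bs)) \<le> input_end" "(as, bs) \<in> set L"
          using inv i by (auto simp: I_def)
        fix t r'' M'' assume step: "t \<le> 10 * (length as + length bs) + 10"
          "same_outside_marks M' M''" "r'' 6 = r' 6 + length (encode_implication (as, bs))"
          "marked M'' = fire (as, bs) (marked M')" "\<forall>j. j \<notin> {3, 4, 5, 6} \<longrightarrow> r'' j = r' j"
        have "same_outside_marks M M''" using inv step(2) same_outside_marks_trans by (auto simp: I_def)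
        then show "wp (Sub 2 2 40) (\<lambda>u. wp Skip (\<lambda>ua s'. t + (u + ua) \<le> 10 * implication_cost i + 12
            \<and> I rest s')) (r'', M'')"
          using inv step one by (simp add: wp_simps I_def i implication_cost_def)
      qed
    qed
  qed (simp add: I_def)
  have "(\<Sum>i\<leftarrow>L. (10 * implication_cost i + 12) + 1) \<le> 13 * weight"
  proof -
    have "(\<Sum>i\<leftarrow>xs. (10 * implication_cost i + 12) + 1) \<le>
        13 * ((\<Sum>(as, bs)\<leftarrow>xs. length as + length bs) + length xs)" for xs
      by (induction xs) (auto simp: implication_cost_def)
    then show ?thesis by (simp add: weight_def)
  qed
  then show ?thesis
    unfolding pass_program_def
    apply (simp add: wp_simps regs)
    apply (rule wp_mono)
     apply (use loop in \<open>simp add: numeral_2_eq_2\<close>)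
    apply (clarsimp simp: I_def wp_simps)
    apply (rule post)
    apply (simp_all)
    done
qed

end

definition holds_array :: "(nat \<Rightarrow> nat) \<Rightarrow> nat \<Rightarrow> nat \<Rightarrow> (nat \<Rightarrow> nat) \<Rightarrow> bool" where
  "holds_array M A n f \<longleftrightarrow> (\<forall>x<n. M (A + x) = f x)"

locale geometry_listing = listing +
  fixes \<psi> :: "nat set \<Rightarrow> nat set"
  assumes geometry: "convex_geometry {..<n} \<psi>"
    and passes_close: "Y \<subseteq> {..<n} \<Longrightarrow> (fold fire L ^^ n) Y = \<psi> Y"
begin

sublocale convex_geometry "{..<n}" \<psi>
  by (rule geometry)

lemma unit_cost_pos: "1 \<le> unit_cost" and n_less_unit_cost: "n < unit_cost"
  by (simp_all add: unit_cost_def)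

lemma wp_closure_program:
  assumes c: "layout r" and stored: "stored M 0 (encode n L)"
    and post: "\<And>t r' M'. \<lbrakk>t \<le> 13 * unit_cost; same_outside_marks M M'; marked M' = \<psi> (marked M);
      \<forall>j\<ge>10. r' j = r j\<rbrakk> \<Longrightarrow> Q t (r', M')"
  shows "wp closure_program Q (r, M)"
proof -
  let ?F = "fold fire L"
  define I :: "nat \<Rightarrow> state \<Rightarrow> bool" where
    "I k = (\<lambda>(r', M'). r' 9 = k \<and> same_outside_marks M M' \<and>
      (?F ^^ k) (marked M') = (?F ^^ n) (marked M) \<and> (\<forall>j\<ge>10. r' j = r j))" for k
  have regs: "r 41 = n" "r 44 = 0" using c by (simp_all add: layout_def)
  have "wp (WhileNonzero 9 (seqs [pass_program, Sub 9 9 40]))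
      (\<lambda>t s'. t \<le> n * ((13 * weight + 8) + 1) + 1 \<and> I 0 s') (r(9 := n), M)"
  proof (rule wp_countdown)
    show "I n (r(9 := n), M)" by (simp add: I_def same_outside_marks_refl)
    show "r' 9 = k" if "I k (r', M')" for k r' M' using that by (simp add: I_def)
    fix k r' M' assume inv: "I (Suc k) (r', M')"
    have c': "layout r'" using c by (rule layout_cong) (use inv in \<open>simp add: I_def\<close>)
    show "wp (seqs [pass_program, Sub 9 9 40]) (\<lambda>t s'. t \<le> 13 * weight + 8 \<and> I k s') (r', M')"
      unfolding seqs.simps wp_Seq
    proof (rule wp_pass_program[OF c'])
      show "stored M' 0 (encode n L)"
        by (rule stored_same_outside_marks[OF _ stored]) (use inv in \<open>simp_all add: I_def input_end_def\<close>)
      fix t r'' M'' assume step: "t \<le> 13 * weight + 5" "same_outside_marks M' M''"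
        "marked M'' = ?F (marked M')" "\<forall>j. j \<notin> {2, 3, 4, 5, 6} \<longrightarrow> r'' j = r' j"
      have "same_outside_marks M M''" using inv step(2) same_outside_marks_trans by (auto simp: I_def)
      moreover have "r'' 40 = 1" using step c' by (simp add: layout_def)
      ultimately show "wp (Sub 9 9 40) (\<lambda>u. wp Skip (\<lambda>ua s'. t + (u + ua) \<le> 13 * weight + 8 \<and> I k s'))
          (r'', M'')"
        using inv step by (simp add: wp_simps I_def funpow_swap1)
    qed
  qed
  then show ?thesis
    unfolding closure_program_def
    apply (simp add: wp_simps regs)
    apply (erule wp_mono)
    apply (clarsimp simp: I_def wp_simps)
    apply (rule post)
       apply (simp_all add: unit_cost_def algebra_simps passes_close[OF marked_subset])
    done
qed

lemma wp_unranked_program: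
  assumes c: "layout r" and f: "holds_array M (r own) n f"
    and own: "own \<ge> 40" "input_end + n \<le> r own"
    and post: "\<And>t r' M'. \<lbrakk>t \<le> 10 * n + 4; same_outside_marks M M';
      marked M' = remaining {..<n} f; \<forall>j. j \<notin> {15, 16, 17} \<longrightarrow> r' j = r j\<rbrakk> \<Longrightarrow> Q t (r', M')"
  shows "wp (unranked_program own) Q (r, M)"
proof -
  define I :: "nat \<Rightarrow> state \<Rightarrow> bool" where
    "I k = (\<lambda>(r', M'). r' 15 = k \<and> k \<le> n \<and> same_outside_marks M M' \<and>
      (\<forall>x<n. k \<le> x \<longrightarrow> (M' (input_end + x) \<noteq> 0 \<longleftrightarrow> f x = 0)) \<and>
      (\<forall>j. j \<notin> {15, 16, 17} \<longrightarrow> r' j = r j))" for k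
  have regs: "r 41 = n" "r 44 = 0" using c by (simp_all add: layout_def)
  let ?body = "seqs [Sub 15 15 40, Add 16 own 15, Load 16 16, Add 17 43 15,
     IfNonzero 16 (Store 17 44) (Store 17 40)]"
  have "wp (WhileNonzero 15 ?body) (\<lambda>t s'. t \<le> n * (8 + 1) + 1 \<and> I 0 s') (r(15 := n), M)"
  proof (rule wp_countdown)
    show "I n (r(15 := n), M)" by (simp add: I_def same_outside_marks_refl)
    show "r' 15 = k" if "I k (r', M')" for k r' M' using that by (simp add: I_def)
    fix k r' M' assume inv: "I (Suc k) (r', M')"
    have k: "k < n" and M': "same_outside_marks M M'" using inv by (simp_all add: I_def)
    have regs': "r' 40 = 1" "r' 43 = input_end" "r' 44 = 0" "r' own = r own" "r' 15 = Suc k"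
      using inv c own by (simp_all add: I_def layout_def)
    have fk: "M' (r own + k) = f k"
      using M' f own k by (simp add: same_outside_marks_def holds_array_def)
    have upd: "same_outside_marks M (M'(input_end + k := v))" for v
      using same_outside_marks_trans[OF M' same_outside_marks_update[OF k]] .
    have filled: "\<forall>x<n. k \<le> x \<longrightarrow> ((M'(input_end + k := v)) (input_end + x) \<noteq> 0 \<longleftrightarrow> f x = 0)"
      if "v \<noteq> 0 \<longleftrightarrow> f k = 0" for v
      using inv that by (auto simp: I_def le_less Suc_le_eq)
    have "own \<noteq> 15" "own \<noteq> 16" "own \<noteq> 17" using own by auto
    then show "wp ?body (\<lambda>t s'. t \<le> 8 \<and> I k s') (r', M')"
      using inv k regs' fk upd filled
      by (auto simp: wp_simps I_def simp del: fun_upd_apply simp add: fun_upd_other fun_upd_same)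
  qed
  then show ?thesis
    unfolding unranked_program_def
    apply (simp add: wp_simps regs)
    apply (erule wp_mono)
    apply (clarsimp simp: I_def wp_simps)
    apply (rule post)
       apply (auto simp: marked_def remaining_def)
    done
qed

lemma wp_select_body:
  assumes c: "layout r" and stored: "stored M 0 (encode n L)"
    and f: "holds_array M (r own) n f" and g: "holds_array M (r other) n g"
    and own: "own \<ge> 40" "input_end + n \<le> r own" and other: "other \<ge> 40" "input_end + n \<le> r other"
    and k: "r 12 = Suc k" "k < n"
    and skip: "\<And>t r' M'. \<lbrakk>t \<le> 50 * unit_cost; same_outside_marks M M'; r' 12 = k; r' 10 = r 10; r' 11 = r 11;
      \<not> extreme \<psi> (remaining {..<n} f) k \<or> r 10 \<le> g k; \<forall>j\<ge>18. r' j = r j\<rbrakk> \<Longrightarrow> Q t (r', M')"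
    and improve: "\<And>t r' M'. \<lbrakk>t \<le> 50 * unit_cost; same_outside_marks M M'; r' 12 = k; r' 10 = g k; r' 11 = k;
      extreme \<psi> (remaining {..<n} f) k; g k < r 10; \<forall>j\<ge>18. r' j = r j\<rbrakk> \<Longrightarrow> Q t (r', M')"
  shows "wp (select_body own other) Q (r, M)"
proof -
  have regs: "r 40 = 1" "r 41 = n" "r 43 = input_end" "r 44 = 0" using c by (simp_all add: layout_def)
  have neq: "own \<noteq> 10" "own \<noteq> 11" "own \<noteq> 12" "own \<noteq> 13" "own \<noteq> 14" "own \<noteq> 15" "own \<noteq> 16" "own \<noteq> 17"
      "other \<noteq> 10" "other \<noteq> 11" "other \<noteq> 12" "other \<noteq> 13" "other \<noteq> 14" "other \<noteq> 15"
      "other \<noteq> 16" "other \<noteq> 17"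
    using own other by auto
  have fk: "M (r own + k) = f k" using f k by (simp add: holds_array_def)
  show ?thesis
  proof (cases "f k = 0")
    case False
    then have "\<not> extreme \<psi> (remaining {..<n} f) k" by (simp add: extreme_def remaining_def)
    then show ?thesis
      unfolding select_body_def using False unit_cost_pos
      by (simp add: wp_simps regs neq k fk) (rule skip, simp_all add: same_outside_marks_refl)
  next
    case True
    let ?R = "remaining {..<n} f"
    have kR: "k \<in> ?R" using True k by (simp add: remaining_def)
    show ?thesis
      unfolding select_body_def
      apply (simp add: wp_simps regs neq k fk True)
      apply (rule wp_unranked_program[where own = own and f = f])
      subgoal using c by (rule layout_cong) simp
      subgoal using f neq by simp
      subgoal by (rule own)
      subgoal using own neq by simp
      subgoal premises p for t r1 M1
      proof -
        have r1: "r1 12 = k" "r1 10 = r 10" "r1 11 = r 11" "\<forall>j\<ge>18. r1 j = r j"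
          using p(4) by simp_all
        have c1: "layout r1" using c by (rule layout_cong) (use r1 in simp)
        then have regs1: "r1 40 = 1" "r1 43 = input_end" "r1 44 = 0" by (simp_all add: layout_def)
        have M1: "same_outside_marks M (M1(input_end + k := 0))"
          using same_outside_marks_trans[OF p(2) same_outside_marks_update[OF k(2)]] .
        show ?thesis
          apply (simp add: wp_simps regs1 r1)
          apply (rule wp_closure_program)
          subgoal using c1 by (rule layout_cong) simp
          subgoal by (rule stored_same_outside_marks[OF M1 stored]) (simp add: input_end_def)
          subgoal premises q for u r2 M2
          proof -
            have r2: "r2 12 = k" "r2 10 = r 10" "r2 11 = r 11" "\<forall>j\<ge>18. r2 j = r j"
              using q(4) r1 by simp_all
            have regs2: "r2 40 = 1" "r2 43 = input_end" "r2 44 = 0" "r2 own = r own" "r2 other = r other"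
              using c r2 own other by (simp_all add: layout_def)
            have M2: "same_outside_marks M M2" using same_outside_marks_trans[OF M1 q(2)] .
            have gk: "M2 (r other + k) = g k"
              using M2 g other k by (simp add: same_outside_marks_def holds_array_def)
            have ext: "M2 (input_end + k) = 0 \<longleftrightarrow> extreme \<psi> ?R k"
            proof -
              have "marked M2 = \<psi> (?R - {k})" using q(3) p(3) by (simp add: marked_remove)
              moreover have "k \<in> marked M2 \<longleftrightarrow> M2 (input_end + k) \<noteq> 0" using k by (simp add: marked_def)
              ultimately show ?thesis using kR by (simp add: extreme_def)
            qed
            have tu: "t + u + 20 \<le> 50 * unit_cost" using p(1) q(1) unit_cost_pos n_less_unit_cost by simp
            show ?thesis
            proof (cases "extreme \<psi> ?R k \<and> g k < r 10")
              case True
              then show ?thesis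
                using tu by (simp add: wp_simps regs2 r2 neq ext gk) (rule improve, simp_all add: M2 r2)
            next
              case False
              then show ?thesis
                using tu by (auto simp add: wp_simps regs2 r2 neq ext gk not_less
                  intro!: skip simp: M2 r2)
            qed
          qed
          done
      qed
      done
  qed
qed

text \<open>
  The loop keeps the invariant that the candidate is an extreme point of smallest rank among
  those examined; as long as there is none, the best rank exceeds \<open>n\<close>.
\<close>

lemma wp_peel_program:
  assumes c: "layout r" and stored: "stored M 0 (encode n L)"
    and f: "holds_array M (r own) n f" and g: "holds_array M (r other) n g"
    and own: "own \<ge> 40" "input_end + n \<le> r own" and other: "other \<ge> 40" "input_end + n \<le> r other"
    and disjoint: "r own + n \<le> r other \<or> r other + n \<le> r own"
    and gn: "\<And>x. x < n \<Longrightarrow> g x \<le> n"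
    and ex: "\<exists>x. extreme \<psi> (remaining {..<n} f) x"
    and post: "\<And>t r' M' x. \<lbrakk>t \<le> 65 * unit_cost * (n + 1); greedy_choice {..<n} \<psi> f g x;
      holds_array M' (r own) n (f(x := r 30)); holds_array M' (r other) n g;
      stored M' 0 (encode n L); \<forall>j\<ge>18. r' j = r j\<rbrakk> \<Longrightarrow> Q t (r', M')"
  shows "wp (peel_program own other) Q (r, M)"
proof -
  let ?ext = "extreme \<psi> (remaining {..<n} f)"
  have ext_less: "x < n" if "?ext x" for x using that by (simp add: extreme_def remaining_def)
  have regs: "r 40 = 1" "r 41 = n" "r 44 = 0" using c by (simp_all add: layout_def)
  define I :: "nat \<Rightarrow> state \<Rightarrow> bool" where
    "I k = (\<lambda>(r', M'). r' 12 = k \<and> k \<le> n \<and> same_outside_marks M M' \<and> (\<forall>j\<ge>18. r' j = r j) \<and>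
      (\<forall>x. ?ext x \<and> k \<le> x \<longrightarrow> r' 10 \<le> g x) \<and>
      (r' 10 \<le> n \<longrightarrow> ?ext (r' 11) \<and> g (r' 11) = r' 10))" for k
  let ?r = "r(10 := Suc n, 11 := 0, 12 := n)"
  have "wp (WhileNonzero 12 (select_body own other))
      (\<lambda>t s'. t \<le> n * (50 * unit_cost + 1) + 1 \<and> I 0 s') (?r, M)"
  proof (rule wp_countdown)
    show "I n (?r, M)" using ext_less by (fastforce simp: I_def same_outside_marks_refl)
    show "r' 12 = k" if "I k (r', M')" for k r' M' using that by (simp add: I_def)
    fix k r' M' assume inv: "I (Suc k) (r', M')"
    have M': "same_outside_marks M M'" and r': "\<forall>j\<ge>18. r' j = r j" and kn: "k < n"
      using inv by (simp_all add: I_def)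
    have eq: "r' own = r own" "r' other = r other" using r' own other by simp_all
    show "wp (select_body own other) (\<lambda>t s'. t \<le> 50 * unit_cost \<and> I k s') (r', M')"
    proof (rule wp_select_body[where f = f and g = g and k = k])
      show "layout r'" using c by (rule layout_cong) (use r' in simp)
      show "stored M' 0 (encode n L)"
        by (rule stored_same_outside_marks[OF M' stored]) (simp add: input_end_def)
      show "holds_array M' (r' own) n f" "holds_array M' (r' other) n g"
        using f g M' own other unfolding eq by (simp_all add: holds_array_def same_outside_marks_def)
      show "40 \<le> own" "40 \<le> other" "input_end + n \<le> r' own" "input_end + n \<le> r' other"
        using own other eq by simp_all
      show "r' 12 = Suc k" "k < n" using inv kn by (simp_all add: I_def)
    next
      fix t r'' M'' assume a: "t \<le> 50 * unit_cost" "same_outside_marks M' M''" "r'' 12 = k" "r'' 10 = r' 10"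
        "r'' 11 = r' 11" "\<not> ?ext k \<or> r' 10 \<le> g k" "\<forall>j\<ge>18. r'' j = r' j"
      have "r' 10 \<le> g x" if "?ext x" "k \<le> x" for x
        using that a(6) inv by (cases "x = k") (auto simp: I_def)
      then show "t \<le> 50 * unit_cost \<and> I k (r'', M'')"
        using a inv same_outside_marks_trans[OF M' a(2)] by (simp add: I_def)
    next
      fix t r'' M'' assume a: "t \<le> 50 * unit_cost" "same_outside_marks M' M''" "r'' 12 = k" "r'' 10 = g k"
        "r'' 11 = k" "?ext k" "g k < r' 10" "\<forall>j\<ge>18. r'' j = r' j"
      have "g k \<le> g x" if "?ext x" "k \<le> x" for x
        using that a(7) inv by (cases "x = k") (auto simp: I_def dest!: spec[of _ x])
      then show "t \<le> 50 * unit_cost \<and> I k (r'', M'')"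
        using a inv same_outside_marks_trans[OF M' a(2)] by (simp add: I_def)
    qed
  qed
  then show ?thesis
    unfolding peel_program_def
    apply (simp add: wp_simps regs)
    apply (erule wp_mono)
    subgoal premises p for t r' M'
    proof -
      have t: "t \<le> n * (50 * unit_cost + 1) + 1" and inv: "I 0 (r', M')" using p by simp_all
      let ?x = "r' 11"
      have M': "same_outside_marks M M'" and r': "\<forall>j\<ge>18. r' j = r j" using inv by (simp_all add: I_def)
      have "r' 10 \<le> n"
        using ex inv gn ext_less unfolding I_def by (auto intro: order_trans)
      then have x: "?ext ?x" "\<forall>y. ?ext y \<longrightarrow> g ?x \<le> g y" using inv by (simp_all add: I_def)
      have xn: "?x < n" using ext_less[OF x(1)] .
      have eq: "r' own = r own" "r' 30 = r 30" "own \<noteq> 13" "own \<noteq> 11" using r' own by auto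
      have time: "t + 20 \<le> 65 * unit_cost * (n + 1)"
        using t unit_cost_pos n_less_unit_cost by (simp add: algebra_simps)
      show ?thesis
        using p
        apply (simp add: wp_simps eq)
        apply (rule post[of _ ?x])
        subgoal using time by simp
        subgoal using x by (simp add: greedy_choice_def)
        subgoal using f M' own(2) by (auto simp: holds_array_def same_outside_marks_def)
        subgoal using g M' other(2) disjoint xn by (auto simp: holds_array_def same_outside_marks_def)
        subgoal by (rule stored_cong[OF stored_same_outside_marks[OF M' stored]])
           (use own(2) in \<open>auto simp: input_end_def\<close>)
        subgoal using r' by simp
        done
    qed
    done
qed

end


section \<open>Verifying the candidate realizer on the machine\<close>

definition clear_program :: program where
  "clear_program = seqs [Add 15 41 44, WhileNonzero 15 (seqs [Sub 15 15 40, Add 17 43 15, Store 17 44])]"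

text \<open>
  For points \<open>a\<close> and \<open>b\<close> whose ranks are in registers 22 and 23: is every point that is bounded by
  \<open>a\<close> in the first ranking and by \<open>b\<close> in the second one marked?
\<close>

definition box_program :: program where
  "box_program = seqs [Add 15 41 44, WhileNonzero 15 (seqs
    [Sub 15 15 40, Add 16 43 15, Load 16 16,
     IfNonzero 16 Skip (seqs
       [Add 16 45 15, Load 16 16, Sub 16 16 22,
        IfNonzero 16 Skip (seqs
          [Add 16 46 15, Load 16 16, Sub 16 16 23, IfNonzero 16 Skip (Const 31 0)])])])]"

definition pair_body :: program where
  "pair_body = seqs
    [Sub 21 21 40, Add 16 46 21, Load 23 16, clear_program, Add 17 43 20, Store 17 40,
     Add 17 43 21, Store 17 40, closure_program, box_program]"

text \<open>
  Subtraction is truncated, so the sum of both differences vanishes exactly if the ranks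
  agree.
\<close>

definition point_body :: program where
  "point_body = seqs
    [Sub 20 20 40, Add 16 45 20, Load 22 16, Add 16 46 20, Load 17 16,
     Sub 16 22 17, Sub 17 17 22, Add 16 16 17, IfNonzero 16 (Const 32 1) Skip,
     Add 21 41 44, WhileNonzero 21 pair_body]"

definition verify_program :: program where
  "verify_program = seqs [Const 31 1, Const 32 0, Add 20 41 44, WhileNonzero 20 point_body]"

text \<open>
  The step of the loops that count down through the points not yet examined.
\<close>

lemma all_from_Suc:
  fixes k n :: nat
  assumes "k < n"
  shows "(\<forall>x. k \<le> x \<and> x < n \<longrightarrow> P x) \<longleftrightarrow> P k \<and> (\<forall>x. Suc k \<le> x \<and> x < n \<longrightarrow> P x)"
proof -
  have "{k..<n} = insert k {Suc k..<n}" using assms by auto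
  then have "(\<forall>x\<in>{k..<n}. P x) \<longleftrightarrow> P k \<and> (\<forall>x\<in>{Suc k..<n}. P x)" by simp
  then show ?thesis by (simp only: Ball_def atLeastLessThan_iff)
qed

context geometry_listing
begin

lemma ranked_le: "ranked_down_to {..<n} \<psi> v f \<Longrightarrow> x < n \<Longrightarrow> f x \<le> n"
proof (cases "f x = 0")
  case False
  assume f: "ranked_down_to {..<n} \<psi> v f" and "x < n"
  then have "f x \<in> f ` ({..<n} - remaining {..<n} f)" using False by (simp add: remaining_def)
  then show ?thesis using f by (auto simp: ranked_down_to_def)
qed simp

text \<open>
  Each iteration is one round of \<open>peeling\<close>; the second call of the choice program has the roles of
  the arrays exchanged.
\<close>

lemma wp_peeling_program:
  assumes c: "layout r" and stored: "stored M 0 (encode n L)"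
    and init: "holds_array M (input_end + n) n (\<lambda>_. 0)" "holds_array M (input_end + 2 * n) n (\<lambda>_. 0)"
    and post: "\<And>t r' M' f g. \<lbrakk>t \<le> 150 * unit_cost * (n + 1) * (n + 1); peeling {..<n} \<psi> 0 f g;
      holds_array M' (input_end + n) n f; holds_array M' (input_end + 2 * n) n g; stored M' 0 (encode n L);
      \<forall>j\<ge>31. r' j = r j\<rbrakk> \<Longrightarrow> Q t (r', M')"
  shows "wp peeling_program Q (r, M)"
proof -
  have regs: "r 40 = 1" "r 41 = n" "r 44 = 0" using c by (simp_all add: layout_def)
  define I :: "nat \<Rightarrow> state \<Rightarrow> bool" where
    "I k = (\<lambda>(r', M'). r' 30 = k \<and> (\<forall>j\<ge>31. r' j = r j) \<and> stored M' 0 (encode n L) \<and>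
      (\<exists>f g. peeling {..<n} \<psi> k f g \<and> holds_array M' (input_end + n) n f \<and>
        holds_array M' (input_end + 2 * n) n g))" for k
  let ?body = "seqs [peel_program 45 46, peel_program 46 45, Sub 30 30 40]"
  have "wp (WhileNonzero 30 ?body)
      (\<lambda>t s'. t \<le> n * (141 * unit_cost * (n + 1) + 1) + 1 \<and> I 0 s') (r(30 := n), M)"
  proof (rule wp_countdown)
    have "peeling {..<n} \<psi> n (\<lambda>_. 0) (\<lambda>_. 0)" using peeling.start[of "{..<n}" \<psi>] by simp
    then show "I n (r(30 := n), M)" using stored init by (auto simp: I_def)
    show "r' 30 = k" if "I k (r', M')" for k r' M' using that by (simp add: I_def)
    fix k r1 M1 assume inv: "I (Suc k) (r1, M1)"
    obtain f g where peel: "peeling {..<n} \<psi> (Suc k) f g"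
      and f: "holds_array M1 (input_end + n) n f" and g: "holds_array M1 (input_end + 2 * n) n g"
      using inv by (auto simp: I_def)
    have rkf: "ranked_down_to {..<n} \<psi> (Suc k) f" and rkg: "ranked_down_to {..<n} \<psi> (Suc k) g"
      using peeling_ranked[OF peel] by auto
    have r1: "r1 30 = Suc k" "\<forall>j\<ge>31. r1 j = r j" using inv by (simp_all add: I_def)
    have c1: "layout r1" using c by (rule layout_cong) (use r1 in simp)
    have ad1: "r1 45 = input_end + n" "r1 46 = input_end + 2 * n" using c1 by (simp_all add: layout_def)
    show "wp ?body (\<lambda>t s'. t \<le> 141 * unit_cost * (n + 1) \<and> I k s') (r1, M1)"
      unfolding seqs.simps wp_Seq
    proof (rule wp_peel_program[where own = 45 and other = 46 and f = f and g = g, OF c1])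
      show "stored M1 0 (encode n L)" using inv by (simp add: I_def)
      show "holds_array M1 (r1 45) n f" "holds_array M1 (r1 46) n g" using f g ad1 by simp_all
      show "g x \<le> n" if "x < n" for x using ranked_le[OF rkg that] .
      show "\<exists>x. extreme \<psi> (remaining {..<n} f) x"
        using ex_greedy_choice[OF rkf, of g] by (auto simp: greedy_choice_def)
    next
      fix t r2 M2 x assume s2: "t \<le> 65 * unit_cost * (n + 1)" "greedy_choice {..<n} \<psi> f g x"
        "holds_array M2 (r1 45) n (f(x := r1 30))" "holds_array M2 (r1 46) n g"
        "stored M2 0 (encode n L)" "\<forall>j\<ge>18. r2 j = r1 j"
      let ?f = "f(x := Suc k)"
      have rkf': "ranked_down_to {..<n} \<psi> k ?f"
        using ranked_peel[OF rkf] s2(2) by (simp add: greedy_choice_def)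
      have c2: "layout r2" using c1 by (rule layout_cong) (use s2 in simp)
      have ad2: "r2 45 = input_end + n" "r2 46 = input_end + 2 * n" using c2 by (simp_all add: layout_def)
      show "wp (peel_program 46 45) (\<lambda>t'. wp (Sub 30 30 40) (\<lambda>t''. wp Skip (\<lambda>u s'.
          t + (t' + (t'' + u)) \<le> 141 * unit_cost * (n + 1) \<and> I k s'))) (r2, M2)"
      proof (rule wp_peel_program[where own = 46 and other = 45 and f = g and g = ?f, OF c2])
        show "stored M2 0 (encode n L)" by (rule s2(5))
        show "holds_array M2 (r2 46) n g" "holds_array M2 (r2 45) n ?f"
          using s2(3,4) ad1 ad2 r1(1) by simp_all
        show "?f y \<le> n" if "y < n" for y using ranked_le[OF rkf' that] .
        show "\<exists>x. extreme \<psi> (remaining {..<n} g) x"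
          using ex_greedy_choice[OF rkg, of ?f] by (auto simp: greedy_choice_def)
      next
        fix u r3 M3 y assume s3: "u \<le> 65 * unit_cost * (n + 1)" "greedy_choice {..<n} \<psi> g ?f y"
          "holds_array M3 (r2 46) n (g(y := r2 30))" "holds_array M3 (r2 45) n ?f"
          "stored M3 0 (encode n L)" "\<forall>j\<ge>18. r3 j = r2 j"
        have "r2 30 = Suc k" "r3 30 = Suc k" using s3(6) s2(6) r1(1) by simp_all
        moreover have "\<exists>f g. peeling {..<n} \<psi> k f g \<and> holds_array M3 (input_end + n) n f \<and>
            holds_array M3 (input_end + 2 * n) n g"
          using peeling.round[OF peel s2(2) s3(2)] s3(3,4) unfolding ad2 calculation(1) by blast
        moreover have "r3 40 = 1" "\<forall>j\<ge>31. r3 j = r j"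
          using s3(6) s2(6) r1(2) c2 by (simp_all add: layout_def)
        moreover have "t + u + 5 \<le> 141 * unit_cost * (n + 1)"
          using s2(1) s3(1) unit_cost_pos by (simp add: algebra_simps)
        ultimately show "wp (Sub 30 30 40) (\<lambda>t''. wp Skip (\<lambda>v s'.
            t + (u + (t'' + v)) \<le> 141 * unit_cost * (n + 1) \<and> I k s')) (r3, M3)"
          using s3(5) by (simp add: wp_simps I_def)
      qed (use ad2 in simp_all)
    qed (use ad1 in simp_all)
  qed
  then show ?thesis
    unfolding peeling_program_def
    apply (simp add: wp_simps regs)
    apply (erule wp_mono)
    subgoal premises p for t r' M'
    proof -
      have t: "t + 5 \<le> 150 * unit_cost * (n + 1) * (n + 1)"
      proof -
        have "n * (141 * unit_cost * (n + 1) + 1) + 1 + 5 \<le> (n + 1) * (150 * unit_cost * (n + 1))"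
        proof -
          have "141 * unit_cost * (n + 1) + 1 \<le> 150 * unit_cost * (n + 1)" "6 \<le> 150 * unit_cost * (n + 1)"
            using unit_cost_pos by simp_all
          then have "n * (141 * unit_cost * (n + 1) + 1) + 6 \<le> n * (150 * unit_cost * (n + 1)) + 150 * unit_cost * (n + 1)"
            by (intro add_mono mult_le_mono2)
          then show ?thesis by simp
        qed
        moreover have "t \<le> n * (141 * unit_cost * (n + 1) + 1) + 1" using p by simp
        ultimately show ?thesis by (simp only: ac_simps)
      qed
      obtain f g where "peeling {..<n} \<psi> 0 f g" "holds_array M' (input_end + n) n f"
          "holds_array M' (input_end + 2 * n) n g" "stored M' 0 (encode n L)" "\<forall>j\<ge>31. r' j = r j"
        using p by (auto simp: I_def)
      then show ?thesis using t by (auto simp: wp_simps intro!: post)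
    qed
    done
qed

lemma wp_clear_program:
  assumes c: "layout r"
    and post: "\<And>t r' M'. \<lbrakk>t \<le> 10 * n + 4; same_outside_marks M M'; marked M' = {};
      \<forall>j. j \<notin> {15, 17} \<longrightarrow> r' j = r j\<rbrakk> \<Longrightarrow> Q t (r', M')"
  shows "wp clear_program Q (r, M)"
proof -
  define I :: "nat \<Rightarrow> state \<Rightarrow> bool" where
    "I k = (\<lambda>(r', M'). r' 15 = k \<and> k \<le> n \<and> same_outside_marks M M' \<and>
      (\<forall>x<n. k \<le> x \<longrightarrow> M' (input_end + x) = 0) \<and> (\<forall>j. j \<notin> {15, 17} \<longrightarrow> r' j = r j))" for k
  have regs: "r 41 = n" "r 44 = 0" using c by (simp_all add: layout_def)
  let ?body = "seqs [Sub 15 15 40, Add 17 43 15, Store 17 44]"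
  have "wp (WhileNonzero 15 ?body) (\<lambda>t s'. t \<le> n * (5 + 1) + 1 \<and> I 0 s') (r(15 := n), M)"
  proof (rule wp_countdown)
    show "I n (r(15 := n), M)" by (simp add: I_def same_outside_marks_refl)
    show "r' 15 = k" if "I k (r', M')" for k r' M' using that by (simp add: I_def)
    fix k r' M' assume inv: "I (Suc k) (r', M')"
    have k: "k < n" and M': "same_outside_marks M M'" using inv by (simp_all add: I_def)
    have regs': "r' 40 = 1" "r' 43 = input_end" "r' 44 = 0" "r' 15 = Suc k"
      using inv c by (simp_all add: I_def layout_def)
    have "same_outside_marks M (M'(input_end + k := 0))"
      using same_outside_marks_trans[OF M' same_outside_marks_update[OF k]] .
    moreover have "\<forall>x<n. k \<le> x \<longrightarrow> (M'(input_end + k := 0)) (input_end + x) = 0"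
      using inv by (auto simp: I_def le_less Suc_le_eq)
    ultimately show "wp ?body (\<lambda>t s'. t \<le> 5 \<and> I k s') (r', M')"
      using inv k regs' by (auto simp: wp_simps I_def simp del: fun_upd_apply simp add: fun_upd_other fun_upd_same)
  qed
  then show ?thesis
    unfolding clear_program_def
    apply (simp add: wp_simps regs)
    apply (erule wp_mono)
    apply (clarsimp simp: I_def wp_simps)
    apply (rule post)
       apply (auto simp: marked_def)
    done
qed

lemma wp_box_program:
  assumes c: "layout r" and f: "holds_array M (input_end + n) n f" and g: "holds_array M (input_end + 2 * n) n g"
    and post: "\<And>t r'. \<lbrakk>t \<le> 18 * n + 4;
      r' 31 \<noteq> 0 \<longleftrightarrow> r 31 \<noteq> 0 \<and> (\<forall>x<n. f x \<le> r 22 \<longrightarrow> g x \<le> r 23 \<longrightarrow> x \<in> marked M);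
      \<forall>j. j \<notin> {15, 16, 31} \<longrightarrow> r' j = r j\<rbrakk> \<Longrightarrow> Q t (r', M)"
  shows "wp box_program Q (r, M)"
proof -
  let ?good = "\<lambda>x. f x \<le> r 22 \<longrightarrow> g x \<le> r 23 \<longrightarrow> x \<in> marked M"
  define above where "above k \<longleftrightarrow> (\<forall>x. k \<le> x \<and> x < n \<longrightarrow> ?good x)" for k
  define I :: "nat \<Rightarrow> state \<Rightarrow> bool" where
    "I k = (\<lambda>(r', M'). r' 15 = k \<and> k \<le> n \<and> M' = M \<and>
      (r' 31 \<noteq> 0 \<longleftrightarrow> r 31 \<noteq> 0 \<and> above k) \<and>
      (\<forall>j. j \<notin> {15, 16, 31} \<longrightarrow> r' j = r j))" for k
  have regs: "r 41 = n" "r 44 = 0" using c by (simp_all add: layout_def)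
  let ?body = "seqs
    [Sub 15 15 40, Add 16 43 15, Load 16 16,
     IfNonzero 16 Skip (seqs
       [Add 16 45 15, Load 16 16, Sub 16 16 22,
        IfNonzero 16 Skip (seqs
          [Add 16 46 15, Load 16 16, Sub 16 16 23, IfNonzero 16 Skip (Const 31 0)])])]"
  have "wp (WhileNonzero 15 ?body) (\<lambda>t s'. t \<le> n * (16 + 1) + 1 \<and> I 0 s') (r(15 := n), M)"
  proof (rule wp_countdown)
    have "above n" by (auto simp: above_def)
    then show "I n (r(15 := n), M)" by (simp add: I_def)
    show "r' 15 = k" if "I k (r', M')" for k r' M' using that by (simp add: I_def)
    fix k r' M' assume inv: "I (Suc k) (r', M')"
    have k: "k < n" and M': "M' = M" using inv by (simp_all add: I_def)
    have regs': "r' 40 = 1" "r' 43 = input_end" "r' 45 = input_end + n" "r' 46 = input_end + 2 * n" "r' 15 = Suc k"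
        "r' 22 = r 22" "r' 23 = r 23"
      using inv c by (simp_all add: I_def layout_def)
    have vals: "M (input_end + n + k) = f k" "M (input_end + 2 * n + k) = g k" "M (input_end + k) \<noteq> 0 \<longleftrightarrow> k \<in> marked M"
      using f g k by (simp_all add: holds_array_def marked_def)
    have "above k \<longleftrightarrow> ?good k \<and> above (Suc k)"
      unfolding above_def by (rule all_from_Suc[OF k])
    then show "wp ?body (\<lambda>t s'. t \<le> 16 \<and> I k s') (r', M')"
      using inv k regs' vals M' by (auto simp: wp_simps I_def)
  qed
  then show ?thesis
    unfolding box_program_def
    apply (simp add: wp_simps regs)
    apply (erule wp_mono)
    apply (clarsimp simp: I_def wp_simps)
    apply (rule post)
      apply (simp_all add: above_def)
    done
qed

lemma wp_pair_body:
  assumes c: "layout r" and stored: "stored M 0 (encode n L)"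
    and f: "holds_array M (input_end + n) n f" and g: "holds_array M (input_end + 2 * n) n g"
    and a: "r 20 = a" "a < n" and b: "r 21 = Suc b" "b < n" and r22: "r 22 = f a"
    and post: "\<And>t r' M'. \<lbrakk>t \<le> 60 * unit_cost; same_outside_marks M M'; r' 21 = b;
      r' 31 \<noteq> 0 \<longleftrightarrow> r 31 \<noteq> 0 \<and> (\<forall>x<n. f x \<le> f a \<longrightarrow> g x \<le> g b \<longrightarrow> x \<in> \<psi> {a, b});
      \<forall>j\<ge>18. j \<notin> {21, 23, 31} \<longrightarrow> r' j = r j\<rbrakk> \<Longrightarrow> Q t (r', M')"
  shows "wp pair_body Q (r, M)"
proof -
  have regs: "r 40 = 1" "r 43 = input_end" "r 46 = input_end + 2 * n" using c by (simp_all add: layout_def)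
  have gb: "M (input_end + 2 * n + b) = g b" using g b by (simp add: holds_array_def)
  show ?thesis
    unfolding pair_body_def
    apply (simp add: wp_simps regs b gb)
    apply (rule wp_clear_program)
    subgoal using c by (rule layout_cong) simp
    subgoal premises p for t r1 M1
    proof -
      have r1: "r1 21 = b" "r1 23 = g b" "\<forall>j\<ge>18. j \<notin> {21, 23} \<longrightarrow> r1 j = r j" using p(4) by simp_all
      have c1: "layout r1" using c by (rule layout_cong) (use r1 in simp)
      have regs1: "r1 40 = 1" "r1 43 = input_end" "r1 20 = a" using c1 r1 a by (simp_all add: layout_def)
      let ?M = "M1(input_end + a := Suc 0, input_end + b := Suc 0)"
      have M2: "same_outside_marks M ?M"
        using same_outside_marks_trans[OF same_outside_marks_trans[OF p(2) same_outside_marks_update[OF a(2)]]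
            same_outside_marks_update[OF b(2)]] .
      have z: "marked ?M = {a, b}" using p(3) a b by (auto simp: marked_insert)
      show ?thesis
        apply (simp add: wp_simps regs1 r1)
        apply (rule wp_closure_program)
        subgoal using c1 by (rule layout_cong) simp
        subgoal by (rule stored_same_outside_marks[OF M2 stored]) (simp add: input_end_def)
        subgoal premises q for u r2 M3
        proof -
          have r2: "r2 21 = b" "r2 23 = g b" "r2 22 = f a" "r2 31 = r 31"
              "\<forall>j\<ge>18. j \<notin> {21, 23} \<longrightarrow> r2 j = r j"
            using q(4) r1 r22 by simp_all
          have c2: "layout r2" using c by (rule layout_cong) (use r2 in simp)
          have M3: "same_outside_marks M M3" using same_outside_marks_trans[OF M2 q(2)] .
          have tu: "t + u + 18 * n + 24 \<le> 60 * unit_cost" using p(1) q(1) unit_cost_pos n_less_unit_cost by simp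
          show ?thesis
            apply (simp only: wp_Seq)
            apply (rule wp_box_program[OF c2, where f = f and g = g])
            subgoal using f M3 by (simp add: holds_array_def same_outside_marks_def)
            subgoal using g M3 by (simp add: holds_array_def same_outside_marks_def)
            subgoal premises s for v r3
              apply (simp only: wp_Skip)
              apply (rule post)
              subgoal using s(1) tu by simp
              subgoal by (rule M3)
              subgoal using s(3) r2 by simp
              subgoal using s(2) unfolding r2 q(3) z .
              subgoal using s(3) r2 by simp
              done
            done
        qed
        done
    qed
    done
qed

lemma wp_point_body:
  assumes c: "layout r" and stored: "stored M 0 (encode n L)"
    and f: "holds_array M (input_end + n) n f" and g: "holds_array M (input_end + 2 * n) n g"
    and a: "r 20 = Suc a" "a < n"
    and post: "\<And>t r' M'. \<lbrakk>t \<le> 85 * unit_cost * (n + 1); same_outside_marks M M'; r' 20 = a;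
      r' 31 \<noteq> 0 \<longleftrightarrow> r 31 \<noteq> 0 \<and>
        (\<forall>b<n. \<forall>x<n. f x \<le> f a \<longrightarrow> g x \<le> g b \<longrightarrow> x \<in> \<psi> {a, b});
      r' 32 = (if f a = g a then r 32 else 1);
      \<forall>j\<ge>33. r' j = r j\<rbrakk> \<Longrightarrow> Q t (r', M')"
  shows "wp point_body Q (r, M)"
proof -
  have regs: "r 40 = 1" "r 41 = n" "r 44 = 0" "r 45 = input_end + n" "r 46 = input_end + 2 * n"
    using c by (simp_all add: layout_def)
  have vals: "M (input_end + n + a) = f a" "M (input_end + 2 * n + a) = g a"
    using f g a by (simp_all add: holds_array_def)
  define above where "above k \<longleftrightarrow> (\<forall>b. k \<le> b \<and> b < n \<longrightarrow>
      (\<forall>x<n. f x \<le> f a \<longrightarrow> g x \<le> g b \<longrightarrow> x \<in> \<psi> {a, b}))" for k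
  have loop: "wp (WhileNonzero 21 pair_body) Q' (r0, M)"
    if r0: "r0 20 = a" "r0 21 = n" "r0 22 = f a" "r0 31 = r 31" "\<forall>j\<ge>33. r0 j = r j"
      and Q': "\<And>t r' M'. \<lbrakk>t \<le> n * (60 * unit_cost + 1) + 1; same_outside_marks M M'; r' 20 = a;
        r' 31 \<noteq> 0 \<longleftrightarrow> r 31 \<noteq> 0 \<and> above 0; r' 32 = r0 32; \<forall>j\<ge>33. r' j = r j\<rbrakk> \<Longrightarrow> Q' t (r', M')"
    for r0 Q'
  proof -
    define I :: "nat \<Rightarrow> state \<Rightarrow> bool" where
      "I k = (\<lambda>(r', M'). r' 21 = k \<and> k \<le> n \<and> same_outside_marks M M' \<and>
        (r' 31 \<noteq> 0 \<longleftrightarrow> r 31 \<noteq> 0 \<and> above k) \<and>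
        (\<forall>j\<ge>18. j \<notin> {21, 23, 31} \<longrightarrow> r' j = r0 j))" for k
    have "wp (WhileNonzero 21 pair_body) (\<lambda>t s'. t \<le> n * (60 * unit_cost + 1) + 1 \<and> I 0 s') (r0, M)"
    proof (rule wp_countdown)
      have "above n" by (auto simp: above_def)
      then show "I n (r0, M)" using r0 by (simp add: I_def same_outside_marks_refl)
      show "r' 21 = k" if "I k (r', M')" for k r' M' using that by (simp add: I_def)
      fix k r' M' assume inv: "I (Suc k) (r', M')"
      have k: "k < n" and M': "same_outside_marks M M'" using inv by (simp_all add: I_def)
      have r': "\<forall>j\<ge>18. j \<notin> {21, 23, 31} \<longrightarrow> r' j = r0 j" using inv by (simp add: I_def)
      have step: "above k \<longleftrightarrow> (\<forall>x<n. f x \<le> f a \<longrightarrow> g x \<le> g k \<longrightarrow> x \<in> \<psi> {a, k}) \<and> above (Suc k)"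
        unfolding above_def by (rule all_from_Suc[OF k])
      show "wp pair_body (\<lambda>t s'. t \<le> 60 * unit_cost \<and> I k s') (r', M')"
      proof (rule wp_pair_body[where f = f and g = g and a = a and b = k])
        show "layout r'" using c by (rule layout_cong) (use r' r0 in simp)
        show "stored M' 0 (encode n L)"
          by (rule stored_same_outside_marks[OF M' stored]) (simp add: input_end_def)
        show "holds_array M' (input_end + n) n f" "holds_array M' (input_end + 2 * n) n g"
          using f g M' by (simp_all add: holds_array_def same_outside_marks_def)
        show "r' 20 = a" "a < n" "r' 21 = Suc k" "k < n" "r' 22 = f a"
          using r' r0 a k inv by (simp_all add: I_def)
        fix t r'' M'' assume s: "t \<le> 60 * unit_cost" "same_outside_marks M' M''" "r'' 21 = k"
          "r'' 31 \<noteq> 0 \<longleftrightarrow> r' 31 \<noteq> 0 \<and> (\<forall>x<n. f x \<le> f a \<longrightarrow> g x \<le> g k \<longrightarrow> x \<in> \<psi> {a, k})"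
          "\<forall>j\<ge>18. j \<notin> {21, 23, 31} \<longrightarrow> r'' j = r' j"
        have "r'' 31 \<noteq> 0 \<longleftrightarrow> r 31 \<noteq> 0 \<and> above k" using s(4) inv unfolding step by (auto simp: I_def)
        then show "t \<le> 60 * unit_cost \<and> I k (r'', M'')"
          using s(1,3,5) k r' same_outside_marks_trans[OF M' s(2)] by (simp add: I_def)
      qed
    qed
    then show ?thesis
      by (rule wp_mono, intro Q') (use r0 in \<open>simp_all add: I_def\<close>)
  qed
  have above0: "above 0 \<longleftrightarrow> (\<forall>b<n. \<forall>x<n. f x \<le> f a \<longrightarrow> g x \<le> g b \<longrightarrow> x \<in> \<psi> {a, b})"
    by (simp add: above_def)
  have time: "t + 20 \<le> 85 * unit_cost * (n + 1)" if "t \<le> n * (60 * unit_cost + 1) + 1" for t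
    using that unit_cost_pos n_less_unit_cost by (simp add: algebra_simps)
  show ?thesis
  proof (cases "f a = g a")
    case True
    then show ?thesis
      unfolding point_body_def
      apply (simp add: wp_simps regs vals a)
      apply (rule loop)
           apply simp_all[5]
      apply (simp only: wp_Skip, rule post)
           apply (use time above0 in force)+
      done
  next
    case False
    define d where "d = f a - g a + (g a - f a)"
    have d: "d \<noteq> 0" using False unfolding d_def by linarith
    show ?thesis
      unfolding point_body_def
      apply (simp add: wp_simps regs vals a d_def[symmetric] d)
      apply (rule loop)
           apply simp_all[5]
      apply (simp only: wp_Skip, rule post)
           apply (use False time above0 in force)+
      done
  qed
qed

lemma wp_verify_program:
  assumes c: "layout r" and stored: "stored M 0 (encode n L)"
    and f: "holds_array M (input_end + n) n f" and g: "holds_array M (input_end + 2 * n) n g"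
    and post: "\<And>t r' M'. \<lbrakk>t \<le> 100 * unit_cost * (n + 1) * (n + 1);
      r' 31 \<noteq> 0 \<longleftrightarrow> (\<forall>a<n. \<forall>b<n. \<forall>x<n. f x \<le> f a \<longrightarrow> g x \<le> g b \<longrightarrow> x \<in> \<psi> {a, b});
      r' 32 = (if \<forall>a<n. f a = g a then 0 else 1); \<forall>j\<ge>33. r' j = r j\<rbrakk> \<Longrightarrow> Q t (r', M')"
  shows "wp verify_program Q (r, M)"
proof -
  have regs: "r 40 = 1" "r 41 = n" "r 44 = 0" using c by (simp_all add: layout_def)
  define good where "good a \<longleftrightarrow> (\<forall>b<n. \<forall>x<n. f x \<le> f a \<longrightarrow> g x \<le> g b \<longrightarrow> x \<in> \<psi> {a, b})" for a
  define all_good where "all_good k \<longleftrightarrow> (\<forall>a. k \<le> a \<and> a < n \<longrightarrow> good a)" for k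
  define all_equal where "all_equal k \<longleftrightarrow> (\<forall>a. k \<le> a \<and> a < n \<longrightarrow> f a = g a)" for k
  define I :: "nat \<Rightarrow> state \<Rightarrow> bool" where
    "I k = (\<lambda>(r', M'). r' 20 = k \<and> k \<le> n \<and> same_outside_marks M M' \<and>
      (r' 31 \<noteq> 0 \<longleftrightarrow> all_good k) \<and> r' 32 = (if all_equal k then 0 else 1) \<and>
      (\<forall>j\<ge>33. r' j = r j))" for k
  have "wp (WhileNonzero 20 point_body)
      (\<lambda>t s'. t \<le> n * (85 * unit_cost * (n + 1) + 1) + 1 \<and> I 0 s') (r(31 := 1, 32 := 0, 20 := n), M)"
  proof (rule wp_countdown)
    have "all_good n" "all_equal n" by (auto simp: all_good_def all_equal_def)
    then show "I n (r(31 := 1, 32 := 0, 20 := n), M)" by (simp add: I_def same_outside_marks_refl)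
    show "r' 20 = k" if "I k (r', M')" for k r' M' using that by (simp add: I_def)
    fix k r' M' assume inv: "I (Suc k) (r', M')"
    have k: "k < n" and M': "same_outside_marks M M'" and r': "\<forall>j\<ge>33. r' j = r j"
      using inv by (simp_all add: I_def)
    have step: "all_good k \<longleftrightarrow> good k \<and> all_good (Suc k)"
        "all_equal k \<longleftrightarrow> f k = g k \<and> all_equal (Suc k)"
      unfolding all_good_def all_equal_def by (rule all_from_Suc[OF k])+
    show "wp point_body (\<lambda>t s'. t \<le> 85 * unit_cost * (n + 1) \<and> I k s') (r', M')"
    proof (rule wp_point_body[where f = f and g = g and a = k])
      show "layout r'" using c by (rule layout_cong) (use r' in simp)
      show "stored M' 0 (encode n L)"
        by (rule stored_same_outside_marks[OF M' stored]) (simp add: input_end_def)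
      show "holds_array M' (input_end + n) n f" "holds_array M' (input_end + 2 * n) n g"
        using f g M' by (simp_all add: holds_array_def same_outside_marks_def)
      show "r' 20 = Suc k" "k < n" using inv k by (simp_all add: I_def)
      fix t r'' M'' assume s: "t \<le> 85 * unit_cost * (n + 1)" "same_outside_marks M' M''" "r'' 20 = k"
        "r'' 31 \<noteq> 0 \<longleftrightarrow> r' 31 \<noteq> 0 \<and>
          (\<forall>b<n. \<forall>x<n. f x \<le> f k \<longrightarrow> g x \<le> g b \<longrightarrow> x \<in> \<psi> {k, b})"
        "r'' 32 = (if f k = g k then r' 32 else 1)" "\<forall>j\<ge>33. r'' j = r' j"
      have "r'' 31 \<noteq> 0 \<longleftrightarrow> all_good k"
        using s(4) inv unfolding step good_def[symmetric] by (auto simp: I_def)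
      moreover have "r'' 32 = (if all_equal k then 0 else 1)"
        using s(5) inv unfolding step by (simp add: I_def)
      ultimately show "t \<le> 85 * unit_cost * (n + 1) \<and> I k (r'', M'')"
        using s(1,3,6) k r' same_outside_marks_trans[OF M' s(2)] by (simp add: I_def)
    qed
  qed
  then show ?thesis
    unfolding verify_program_def
    apply (simp add: wp_simps regs)
    apply (erule wp_mono)
    subgoal premises p for t r' M'
    proof -
      have "n * (85 * unit_cost * (n + 1) + 1) + 10 \<le> 100 * unit_cost * (n + 1) * (n + 1)"
      proof -
        have "85 * unit_cost * (n + 1) + 1 \<le> 100 * unit_cost * (n + 1)" "10 \<le> 100 * unit_cost * (n + 1)"
          using unit_cost_pos by simp_all
        then have "n * (85 * unit_cost * (n + 1) + 1) + 10 \<le> n * (100 * unit_cost * (n + 1)) + 100 * unit_cost * (n + 1)"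
          by (intro add_mono mult_le_mono2)
        then show ?thesis by (simp add: algebra_simps)
      qed
      moreover have "t \<le> n * (85 * unit_cost * (n + 1) + 1) + 1" and inv: "I 0 (r', M')" using p by simp_all
      ultimately have time: "t + 9 \<le> 100 * unit_cost * (n + 1) * (n + 1)" by linarith
      show ?thesis
        apply (simp only: wp_Skip)
        apply (rule post)
        subgoal using time by simp
        subgoal using inv by (simp add: I_def all_good_def good_def)
        subgoal using inv by (simp add: I_def all_equal_def)
        subgoal using inv by (simp add: I_def)
        done
    qed
    done
qed

end


section \<open>The complete program\<close>

definition setup_program :: program where
  "setup_program = seqs
    [Const 40 1, Load 41 44, Load 42 40, Add 6 40 40, Add 2 42 44,
     WhileNonzero 2 (seqs [Load 3 6, Add 6 6 3, Add 6 6 40, Load 3 6, Add 6 6 3, Add 6 6 40, Sub 2 2 40]),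
     Add 43 6 44, Add 45 43 41, Add 46 45 41]"

text \<open>
  Register 4 is non-zero only for an empty basis on at least three points.
\<close>

definition main_program :: program where
  "main_program = seqs
    [setup_program, Const 3 2, Sub 4 41 3, IfNonzero 42 (Const 4 0) Skip,
     IfNonzero 4 (Const 0 0) (seqs
       [peeling_program, verify_program, IfNonzero 31 (Add 0 32 44) (Const 0 0)])]"

lemma (in listing) wp_setup_program:
  assumes stored: "stored M 0 (encode n L)"
    and post: "\<And>t r'. \<lbrakk>t \<le> 10 * length L + 20; layout r'\<rbrakk> \<Longrightarrow> Q t (r', M)"
  shows "wp setup_program Q (\<lambda>_. 0, M)"
proof -
  have M: "M 0 = n" "M (Suc 0) = length L" "stored M 2 (concat (map encode_implication L))"
    using stored by (simp_all add: encode_def numeral_2_eq_2)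
  define r :: "nat \<Rightarrow> nat" where "r = (\<lambda>_. 0)(40 := 1, 41 := n, 42 := length L, 6 := 2, 2 := length L)"
  define I :: "listed_implication list \<Rightarrow> state \<Rightarrow> bool" where
    "I rest = (\<lambda>(r', M'). M' = M \<and>
      stored M (r' 6) (concat (map encode_implication rest)) \<and> r' 2 = length rest \<and>
      r' 6 + length (concat (map encode_implication rest)) = input_end \<and>
      (\<forall>j. j \<notin> {2, 3, 6} \<longrightarrow> r' j = r j))" for rest
  let ?body = "seqs [Load 3 6, Add 6 6 3, Add 6 6 40, Load 3 6, Add 6 6 3, Add 6 6 40, Sub 2 2 40]"
  have "wp (WhileNonzero 2 ?body) (\<lambda>t s'. t \<le> (\<Sum>i\<leftarrow>L. 8 + 1) + 1 \<and> I [] s') (r, M)"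
  proof (rule wp_foreach)
    show "I L (r, M)" using M by (simp add: I_def r_def input_end_def encode_def)
    fix i rest r' M' assume inv: "I (i # rest) (r', M')"
    obtain as bs where i: "i = (as, bs)" by force
    have one: "r' 40 = 1" using inv by (simp add: I_def r_def)
    show "r' 2 \<noteq> 0 \<and> wp ?body (\<lambda>t s'. t \<le> 8 \<and> I rest s') (r', M')"
      using inv by (simp add: wp_simps I_def i one encode_implication_def add.commute add.left_commute)
  qed (simp add: I_def)
  then show ?thesis
    unfolding setup_program_def
    apply (simp add: wp_simps M)
    apply (rule wp_mono)
     apply (simp add: r_def numeral_2_eq_2)
    apply (clarsimp simp: I_def wp_simps sum_list_triv)
    apply (rule post)
     apply (simp_all add: r_def layout_def)
    done
qed

context geometry_listing
begin

lemma wp_main_program_trivial: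
  assumes stored: "stored M 0 (encode n L)" and "L = []" "3 \<le> n"
    and post: "\<And>t r'. \<lbrakk>t \<le> 60; r' 0 = 0\<rbrakk> \<Longrightarrow> Q t (r', M)"
  shows "wp main_program Q (\<lambda>_. 0, M)"
  unfolding main_program_def seqs.simps wp_Seq
proof (rule wp_setup_program[OF stored])
  fix t r assume t: "t \<le> 10 * length L + 20" and c: "layout r"
  have "r 41 = n" "r 42 = length L" using c by (simp_all add: layout_def)
  moreover have "length L = 0" "n - 2 \<noteq> 0" using assms(2,3) by simp_all
  ultimately show "wp (Const 3 2) (\<lambda>t'. wp (Sub 4 41 3) (\<lambda>u. wp (IfNonzero 42 (Const 4 0) Skip)
      (\<lambda>v. wp (IfNonzero 4 (Const 0 0) (Seq peeling_program (Seq verify_program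
        (Seq (IfNonzero 31 (Add 0 32 44) (Const 0 0)) Skip)))) (\<lambda>w. wp Skip
          (\<lambda>z. Q (t + (t' + (u + (v + (w + z))))))))) ) (r, M)"
    using t by (simp add: wp_simps) (rule post, simp_all)
qed

lemma wp_main_program:
  assumes stored: "stored M 0 (encode n L)" and nontrivial: "\<not> (L = [] \<and> 3 \<le> n)"
    and fresh: "\<And>a. input_end \<le> a \<Longrightarrow> M a = 0"
    and post: "\<And>t r' M' f g. \<lbrakk>t \<le> 300 * unit_cost * (n + 1) * (n + 1); peeling {..<n} \<psi> 0 f g;
      r' 0 = (if (\<forall>a<n. \<forall>b<n. \<forall>x<n. f x \<le> f a \<longrightarrow> g x \<le> g b \<longrightarrow> x \<in> \<psi> {a, b}) \<and>
        \<not> (\<forall>a<n. f a = g a) then 1 else 0)\<rbrakk> \<Longrightarrow> Q t (r', M')"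
  shows "wp main_program Q (\<lambda>_. 0, M)"
  unfolding main_program_def seqs.simps wp_Seq
proof (rule wp_setup_program[OF stored])
  fix t r assume t: "t \<le> 10 * length L + 20" and c: "layout r"
  have regs: "r 41 = n" "r 42 = length L" using c by (simp_all add: layout_def)
  have guard: "length L = 0 \<longrightarrow> n \<le> 2" using nontrivial by auto
  have loop: "wp (Seq peeling_program (Seq verify_program
        (Seq (IfNonzero 31 (Add 0 32 44) (Const 0 0)) Skip))) Q' (r0, M)"
    if r0: "\<forall>j\<ge>40. r0 j = r j"
      and Q': "\<And>u r' M' f g. \<lbrakk>u \<le> 250 * unit_cost * (n + 1) * (n + 1) + 10; peeling {..<n} \<psi> 0 f g;
        r' 0 = (if (\<forall>a<n. \<forall>b<n. \<forall>x<n. f x \<le> f a \<longrightarrow> g x \<le> g b \<longrightarrow> x \<in> \<psi> {a, b}) \<and>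
          \<not> (\<forall>a<n. f a = g a) then 1 else 0)\<rbrakk> \<Longrightarrow> Q' u (r', M')"
    for r0 Q'
    unfolding wp_Seq
  proof (rule wp_peeling_program)
    show "layout r0" using c r0 by (rule layout_cong)
    show "stored M 0 (encode n L)" by (rule stored)
    show "holds_array M (input_end + n) n (\<lambda>_. 0)" "holds_array M (input_end + 2 * n) n (\<lambda>_. 0)"
      using fresh by (simp_all add: holds_array_def)
    fix u r1 M1 f g assume s1: "u \<le> 150 * unit_cost * (n + 1) * (n + 1)" "peeling {..<n} \<psi> 0 f g"
      "holds_array M1 (input_end + n) n f" "holds_array M1 (input_end + 2 * n) n g" "stored M1 0 (encode n L)"
      "\<forall>j\<ge>31. r1 j = r0 j"
    have c1: "layout r1" using c by (rule layout_cong) (use r0 s1 in simp)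
    show "wp verify_program (\<lambda>ua. wp (IfNonzero 31 (Add 0 32 44) (Const 0 0))
        (\<lambda>ub. wp Skip (\<lambda>uc. Q' (u + (ua + (ub + uc)))))) (r1, M1)"
    proof (rule wp_verify_program[OF c1 s1(5,3,4)])
      fix v r2 M2 assume s2: "v \<le> 100 * unit_cost * (n + 1) * (n + 1)"
        "r2 31 \<noteq> 0 \<longleftrightarrow> (\<forall>a<n. \<forall>b<n. \<forall>x<n. f x \<le> f a \<longrightarrow> g x \<le> g b \<longrightarrow> x \<in> \<psi> {a, b})"
        "r2 32 = (if \<forall>a<n. f a = g a then 0 else 1)" "\<forall>j\<ge>33. r2 j = r1 j"
      have zero: "r2 44 = 0" using c1 s2(4) by (simp add: layout_def)
      have time: "u + v + 3 \<le> 250 * unit_cost * (n + 1) * (n + 1) + 10"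
        using s1(1) s2(1) by (simp add: algebra_simps)
      let ?ok = "\<forall>a<n. \<forall>b<n. \<forall>x<n. f x \<le> f a \<longrightarrow> g x \<le> g b \<longrightarrow> x \<in> \<psi> {a, b}"
      have Q'': "Q' w (r', M')" if "w \<le> u + v + 3"
        "r' 0 = (if ?ok \<and> \<not> (\<forall>a<n. f a = g a) then 1 else 0)" for w r' M'
        using that time by (intro Q'[of w f g r' M'] s1(2)) simp_all
      show "wp (IfNonzero 31 (Add 0 32 44) (Const 0 0))
          (\<lambda>ub. wp Skip (\<lambda>uc. Q' (u + (v + (ub + uc))))) (r2, M2)"
      proof (cases ?ok)
        case True
        then have "r2 31 \<noteq> 0" using s2(2) by blast
        then show ?thesis
          by (simp add: wp_simps) (rule Q'', use True s2(3) zero in simp_all)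
      next
        case False
        then have "r2 31 = 0" using s2(2) by blast
        then show ?thesis
          by (simp add: wp_simps) (rule Q'', use False in auto)
      qed
    qed
  qed
  have tW: "t + 250 * unit_cost * (n + 1) * (n + 1) + 30 \<le> 300 * unit_cost * (n + 1) * (n + 1)"
  proof -
    have "length L \<le> weight" by (simp add: weight_def)
    then have "length L < unit_cost" by (simp add: unit_cost_def)
    then have "t + 30 \<le> 50 * unit_cost" using t by simp
    also have "\<dots> \<le> 50 * unit_cost * ((n + 1) * (n + 1))" by simp
    finally show ?thesis by (simp add: algebra_simps)
  qed
  show "wp (Const 3 2) (\<lambda>t'. wp (Sub 4 41 3) (\<lambda>u. wp (IfNonzero 42 (Const 4 0) Skip)
      (\<lambda>v. wp (IfNonzero 4 (Const 0 0) (Seq peeling_program (Seq verify_program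
        (Seq (IfNonzero 31 (Add 0 32 44) (Const 0 0)) Skip)))) (\<lambda>w. wp Skip
          (\<lambda>z. Q (t + (t' + (u + (v + (w + z))))))))) ) (r, M)"
  proof (cases "length L = 0")
    case True
    then have "n - 2 = 0" "r 42 = 0" using guard regs by simp_all
    then show ?thesis
      using regs(1) apply (simp only: wp_Const wp_Sub wp_IfNonzero fun_upd_apply)
      apply (simp add: wp_Skip wp_IfNonzero)
      apply (rule loop)
       apply simp
      apply (simp only: wp_Skip, rule post)
        apply (use tW in linarith)
       apply assumption
      apply assumption
      done
  next
    case False
    then have "r 42 \<noteq> 0" using regs by simp
    then show ?thesis
      apply (simp only: wp_Const wp_Sub wp_IfNonzero fun_upd_apply)
      apply (simp add: wp_Skip wp_Const wp_IfNonzero)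
      apply (rule loop)
       apply simp
      apply (simp only: wp_Skip, rule post)
        apply (use tW in linarith)
       apply assumption
      apply assumption
      done
  qed
qed

end

text \<open>
  With \<open>W = k + m\<close> the left-hand side has order \<open>(W + 1) (n + 1)\<^sup>3\<close>. This is the order of \<open>W n\<^sup>3\<close>
  unless \<open>W\<close> or \<open>n\<close> is \<open>0\<close>, and then the hypotheses bound the other one.
\<close>

lemma cubic_time_bound:
  fixes W n :: nat
  assumes "n = 0 \<Longrightarrow> W \<le> 1" "W = 0 \<Longrightarrow> n \<le> 2"
  shows "300 * ((W + 1) * (n + 1)) * (n + 1) * (n + 1) \<le> 10000 * max 1 (W * n ^ 3)"
proof -
  consider "n = 0" | "W = 0" | "W \<ge> 1" "n \<ge> 1" by linarith
  then show ?thesis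
  proof cases
    case 1
    then show ?thesis using assms(1) by simp
  next
    case 2
    then have "n = 0 \<or> n = 1 \<or> n = 2" using assms(2) by linarith
    then show ?thesis using 2 by (elim disjE) simp_all
  next
    case 3
    then have "(W + 1) * (n + 1) * (n + 1) * (n + 1) \<le> (2 * W) * (2 * n) * (2 * n) * (2 * n)"
      by (intro mult_mono) auto
    then have "300 * ((W + 1) * (n + 1)) * (n + 1) * (n + 1) \<le> 10000 * (W * n ^ 3)"
      by (simp add: power3_eq_cube algebra_simps)
    also have "\<dots> \<le> 10000 * max 1 (W * n ^ 3)" by (rule mult_le_mono2) (rule max.cobounded2)
    finally show ?thesis .
  qed
qed

theorem corollary42:
  "\<exists>(P :: program) (C :: nat).
     \<forall>(X :: 'a set) \<phi> S e L n m k.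
       convex_geometry X \<phi> \<and> implicational_basis X \<phi> S \<and> lists_basis X S e L \<and>
       n = card X \<and> m = card S \<and> k = basis_size S \<longrightarrow>
       (\<exists>t s. exec P (initial_state (encode n L)) t s \<and>
              answer s = (if cdim X \<phi> = 2 then 1 else 0) \<and>
              t \<le> C * max 1 ((k + m) * n ^ 3))"
proof (rule exI[of _ main_program], rule exI[of _ 10000], intro allI impI)
  fix X :: "'a set" and \<phi> S e L n m k
  assume asm: "convex_geometry X \<phi> \<and> implicational_basis X \<phi> S \<and> lists_basis X S e L \<and>
       n = card X \<and> m = card S \<and> k = basis_size S"
  interpret convex_geometry X \<phi> using asm by blast
  have S: "implicational_basis X \<phi> S" and L: "lists_basis X S e L" and n: "n = card X" using asm by auto
  let ?\<psi> = "pulled_back {..<n} e \<phi>"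
  have e: "bij_betw e {..<n} X" using L n by (simp add: lists_basis_def)
  interpret gl: geometry_listing n L ?\<psi>
  proof (intro geometry_listing.intro listing.intro geometry_listing_axioms.intro)
    show "set as \<subseteq> {..<n} \<and> set bs \<subseteq> {..<n}" if "(as, bs) \<in> set L" for as bs
      using L n that by (auto simp: lists_basis_def)
  next
    show "convex_geometry {..<n} ?\<psi>" by (rule convex_geometry_pulled_back[OF e])
    show "(fold fire L ^^ n) Y = ?\<psi> Y" if "Y \<subseteq> {..<n}" for Y
      using iterated_pass_eq_closure[OF S L] that n by simp
  qed
  have weight: "gl.weight = k + m" using basis_size_listed[OF L] asm by (simp add: gl.weight_def)
  define M :: "nat \<Rightarrow> nat" where
    "M = (\<lambda>a. if a < length (encode n L) then encode n L ! a else 0)"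
  have init: "initial_state (encode n L) = (\<lambda>_. 0, M)" by (simp add: initial_state_def M_def)
  have stored: "stored M 0 (encode n L)" by (simp add: stored_def M_def)
  have fresh: "M a = 0" if "gl.input_end \<le> a" for a using that by (simp add: gl.input_end_def M_def)
  let ?Q = "\<lambda>t s. answer s = (if cdim X \<phi> = 2 then 1 else 0) \<and>
    t \<le> 10000 * max 1 ((k + m) * n ^ 3)"
  have "wp main_program ?Q (\<lambda>_. 0, M)"
  proof (cases "L = [] \<and> 3 \<le> n")
    case True
    have "S = {}" using L True by (simp add: lists_basis_def)
    then have free: "\<phi> Y = Y" if "Y \<subseteq> X" for Y
      using closed_iff_satisfies_basis[OF S that] by simp
    have "\<not> realizer X \<phi> f g" for f g
    proof
      assume "realizer X \<phi> f g"
      then obtain Y where "Y \<subseteq> X" "\<phi> Y \<noteq> Y"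
        using closure_of_two_points_is_large True n by metis
      then show False using free by simp
    qed
    then have "cdim X \<phi> \<noteq> 2" unfolding cdim_eq_2_iff by blast
    moreover have "60 \<le> 10000 * max 1 ((k + m) * n ^ 3)"
      using max.cobounded1[of 1 "(k + m) * n ^ 3"] by linarith
    ultimately show ?thesis
      by (intro gl.wp_main_program_trivial[OF stored]) (use True in \<open>simp_all add: answer_def\<close>)
  next
    case False
    have bound: "300 * gl.unit_cost * (n + 1) * (n + 1) \<le> 10000 * max 1 ((k + m) * n ^ 3)"
      unfolding gl.unit_cost_def weight
    proof (rule cubic_time_bound)
      \<comment> \<open>On the empty ground set the only implication is the empty one, and it is listed at most once.\<close>
      assume "n = 0"
      then have X: "X = {}" using n finite_ground by simp
      have "i = ([], [])" if "i \<in> set L" for i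
        using L that X by (cases i) (auto simp: lists_basis_def)
      then have "set L \<subseteq> {([], [])}" by blast
      moreover have "distinct L" using L by (simp add: lists_basis_def distinct_map)
      ultimately have "L = [] \<or> L = [([], [])]"
        by (cases L; cases "tl L") auto
      then show "k + m \<le> 1" using weight by (auto simp: gl.weight_def)
    next
      assume "k + m = 0"
      then have "L = []" using weight by (simp add: gl.weight_def)
      then show "n \<le> 2" using False by simp
    qed
    show ?thesis
    proof (rule gl.wp_main_program[OF stored False fresh])
      fix t and r' M' f g :: "nat \<Rightarrow> nat"
      assume t: "t \<le> 300 * gl.unit_cost * (n + 1) * (n + 1)" and peel: "peeling {..<n} ?\<psi> 0 f g"
        and r': "r' 0 = (if (\<forall>a<n. \<forall>b<n. \<forall>x<n. f x \<le> f a \<longrightarrow> g x \<le> g b \<longrightarrow> x \<in> ?\<psi> {a, b}) \<and>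
          \<not> (\<forall>a<n. f a = g a) then 1 else 0)"
      have rk: "ranked_down_to {..<n} ?\<psi> 0 f" "ranked_down_to {..<n} ?\<psi> 0 g"
        using gl.peeling_ranked[OF peel] by auto
      have pairs: "realizer {..<n} ?\<psi> f g \<longleftrightarrow>
          (\<forall>a<n. \<forall>b<n. \<forall>x<n. f x \<le> f a \<longrightarrow> g x \<le> g b \<longrightarrow> x \<in> ?\<psi> {a, b})"
        using gl.realizer_iff_pairs[OF rk] by (simp add: Ball_def)
      have "cdim X \<phi> = 2 \<longleftrightarrow> realizer {..<n} ?\<psi> f g \<and> \<not> (\<forall>a<n. f a = g a)"
        using cdim_eq_2_iff_pulled_back[OF e] gl.peeling_finds_realizer[OF peel]
          gl.peeling_equal_iff_chain[OF peel] by (auto simp: Ball_def)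
      then show "?Q t (r', M')"
        using r' t bound unfolding pairs by (simp add: answer_def)
    qed
  qed
  then show "\<exists>t s. exec main_program (initial_state (encode n L)) t s \<and> ?Q t s"
    unfolding init wp_def .
qed

end
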